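(* In a plane fronted wave $\overline{M}^{n+2}$ there are no parabolic spacelike hypersurfaces $\psi:\Sigma^{n+1}\to\overline{M}^{n+2}$ with non-positive mean curvature ($H\le 0$ on $\Sigma^{n+1}$) and $\mu:=u\circ\psi$ bounded from above, nor parabolic spacelike hypersurfaces with non-negative mean curvature ($H\geq 0$ on $\Sigma^{n+1}$) and $\mu$ bounded from below.
   Context: A plane fronted wave is a Lorentzian manifold $(\overline{M}^{n+2},\langle\ ,\ \rangle)$ with $\overline{M}^{n+2}=\mathbb{R}^2\times M^n$, where $(M^n,g_M)$ is a connected Riemannian manifold, and metric $\langle\ ,\ \rangle=\mathcal{H}(u,x)\,du\otimes du+du\otimes dv+dv\otimes du+g_M$, where $(u,v)$ are the natural coordinates on $\mathbb{R}^2$ and $\mathcal{H}(u,x)$ is a smooth function on $\mathbb{R}^2\times M^n$ independent of $v$. The coordinate vector field $\partial_v=\partial/\partial v$ is lightlike and parallel, and the spacetime is time-oriented by $\partial_v$. A spacelike hypersurface is an immersion $\psi:\Sigma^{n+1}\to\overline{M}^{n+2}$ of a connected $(n+1)$-dimensional manifold whose induced metric is Riemannian. Its mean curvature vector field is $\overrightarrow{H}=\frac1{n+1}\,\mathrm{trace}(\mathrm{II})$, where $\mathrm{II}$ is the second fundamental form, defined by $\overline{\nabla}_XY=\nabla_XY+\mathrm{II}(X,Y)$, with $\overline\nabla$, $\nabla$ the Levi-Civita connections of $\overline{M}^{n+2}$ and $\Sigma^{n+1}$. The unit timelike normal vector field $N$ along $\psi$ is chosen such that $\langle N,\partial_v\rangle<0$,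 and the mean curvature function $H$ is defined by $\overrightarrow{H}=H\,N$. A complete (non-compact) Riemannian manifold is parabolic if the only superharmonic functions ($\Delta f\le 0$, $\Delta=\mathrm{div}\,\nabla$) bounded from below that it admits are the constants. A spacelike hypersurface is parabolic if it is so with its induced metric. *)

theory Defs
  imports "HOL-Analysis.Analysis"
begin

section \<open>Smooth maps between Euclidean spaces\<close>

text \<open>Meant for open \<open>S\<close>: \<open>C_on k\<close> says that all iterated directional derivatives
  up to order \<open>k\<close> exist and are continuous on \<open>S\<close>.\<close>

primrec C_on :: "nat \<Rightarrow> 'a::euclidean_space set \<Rightarrow> ('a \<Rightarrow> 'b::real_normed_vector) \<Rightarrow> bool" where
  "C_on 0 S f \<longleftrightarrow> continuous_on S f"
| "C_on (Suc k) S f \<longleftrightarrow> (\<forall>x\<in>S. f differentiable at x) \<and>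
     (\<forall>v. C_on k S (\<lambda>x. frechet_derivative f (at x) v))"

definition smooth_on :: "'a::euclidean_space set \<Rightarrow> ('a \<Rightarrow> 'b::real_normed_vector) \<Rightarrow> bool" where
  "smooth_on S f \<longleftrightarrow> (\<forall>k. C_on k S f)"


section \<open>Smooth manifolds and smooth maps\<close>

text \<open>A manifold of dimension \<open>DIM('e)\<close> with underlying set \<open>topspace (mtop M)\<close>; its atlas is
  the family of charts \<open>coord M i\<close>, defined on \<open>cdom M i\<close>, for \<open>i \<in> cidx M\<close>. The values of
  \<open>coord M i\<close> outside \<open>cdom M i\<close> are irrelevant.\<close>

record ('i, 'p, 'e) mfd =
  mtop :: "'p topology"
  cidx :: "'i set"
  cdom :: "'i \<Rightarrow> 'p set"
  coord :: "'i \<Rightarrow> 'p \<Rightarrow> 'e"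

definition cimg :: "('i, 'p, 'e, 'z) mfd_scheme \<Rightarrow> 'i \<Rightarrow> 'e set" where
  "cimg M i = coord M i ` cdom M i"

definition param :: "('i, 'p, 'e, 'z) mfd_scheme \<Rightarrow> 'i \<Rightarrow> 'e \<Rightarrow> 'p" where
  "param M i = inv_into (cdom M i) (coord M i)"

definition chart_at :: "('i, 'p, 'e, 'z) mfd_scheme \<Rightarrow> 'p \<Rightarrow> 'i" where
  "chart_at M p = (SOME i. i \<in> cidx M \<and> p \<in> cdom M i)"

definition local_rep ::
  "('i, 'p, 'e, 'z) mfd_scheme \<Rightarrow> ('j, 'q, 'f, 'y) mfd_scheme \<Rightarrow> ('p \<Rightarrow> 'q) \<Rightarrow> 'i \<Rightarrow> 'j \<Rightarrow> 'e \<Rightarrow> 'f" where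
  "local_rep M N f i j = coord N j \<circ> f \<circ> param M i"

definition smooth_manifold :: "('i, 'p, 'e::euclidean_space, 'z) mfd_scheme \<Rightarrow> bool" where
  "smooth_manifold M \<longleftrightarrow>
     Hausdorff_space (mtop M) \<and> second_countable (mtop M) \<and>
     (\<Union>i\<in>cidx M. cdom M i) = topspace (mtop M) \<and>
     (\<forall>i\<in>cidx M. openin (mtop M) (cdom M i) \<and> open (cimg M i) \<and>
        homeomorphic_map (subtopology (mtop M) (cdom M i)) (top_of_set (cimg M i)) (coord M i)) \<and>
     (\<forall>i\<in>cidx M. \<forall>j\<in>cidx M.
        smooth_on (coord M i ` (cdom M i \<inter> cdom M j)) (local_rep M M id i j))"

definition connected_manifold :: "('i, 'p, 'e::euclidean_space, 'z) mfd_scheme \<Rightarrow> bool" where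
  "connected_manifold M \<longleftrightarrow>
     smooth_manifold M \<and> connected_space (mtop M) \<and> topspace (mtop M) \<noteq> {}"

definition smooth_map ::
  "('i, 'p, 'e::euclidean_space, 'z) mfd_scheme \<Rightarrow> ('j, 'q, 'f::euclidean_space, 'y) mfd_scheme
     \<Rightarrow> ('p \<Rightarrow> 'q) \<Rightarrow> bool" where
  "smooth_map M N f \<longleftrightarrow> continuous_map (mtop M) (mtop N) f \<and>
     (\<forall>i\<in>cidx M. \<forall>j\<in>cidx N.
        smooth_on (coord M i ` (cdom M i \<inter> f -` cdom N j)) (local_rep M N f i j))"

definition smooth_fun ::
  "('i, 'p, 'e::euclidean_space, 'z) mfd_scheme \<Rightarrow> ('p \<Rightarrow> real) \<Rightarrow> bool" where
  "smooth_fun M f \<longleftrightarrow> (\<forall>i\<in>cidx M. smooth_on (cimg M i) (f \<circ> param M i))"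

definition immersion ::
  "('i, 'p, 'e::euclidean_space, 'z) mfd_scheme \<Rightarrow> ('j, 'q, 'f::euclidean_space, 'y) mfd_scheme
     \<Rightarrow> ('p \<Rightarrow> 'q) \<Rightarrow> bool" where
  "immersion M N f \<longleftrightarrow> smooth_map M N f \<and>
     (\<forall>i\<in>cidx M. \<forall>j\<in>cidx N. \<forall>y \<in> coord M i ` (cdom M i \<inter> f -` cdom N j).
        inj (frechet_derivative (local_rep M N f i j) (at y)))"


section \<open>Semi-Riemannian geometry in charts\<close>

text \<open>\<open>gmet M i y v w\<close> is the metric at the point with coordinates \<open>y\<close> in chart \<open>i\<close>, evaluated
  on the tangent vectors with components \<open>v\<close> and \<open>w\<close> in that chart.\<close>

record ('i, 'p, 'e) rmfd = "('i, 'p, 'e) mfd" +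
  gmet :: "'i \<Rightarrow> 'e \<Rightarrow> 'e \<Rightarrow> 'e \<Rightarrow> real"

definition metric_tensor :: "('i, 'p, 'e::euclidean_space) rmfd \<Rightarrow> bool" where
  "metric_tensor M \<longleftrightarrow>
     (\<forall>i\<in>cidx M. \<forall>y\<in>cimg M i. bilinear (gmet M i y) \<and>
        (\<forall>v w. gmet M i y v w = gmet M i y w v) \<and>
        (\<forall>v. (\<forall>w. gmet M i y v w = 0) \<longrightarrow> v = 0)) \<and>
     (\<forall>i\<in>cidx M. \<forall>v w. smooth_on (cimg M i) (\<lambda>y. gmet M i y v w)) \<and>
     (\<forall>i\<in>cidx M. \<forall>j\<in>cidx M. \<forall>y \<in> coord M i ` (cdom M i \<inter> cdom M j). \<forall>v w.
        let \<tau> = local_rep M M id i j; D\<tau> = frechet_derivative \<tau> (at y)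
        in gmet M i y v w = gmet M j (\<tau> y) (D\<tau> v) (D\<tau> w))"

definition riemannian :: "('i, 'p, 'e::euclidean_space) rmfd \<Rightarrow> bool" where
  "riemannian M \<longleftrightarrow> smooth_manifold M \<and> metric_tensor M \<and>
     (\<forall>i\<in>cidx M. \<forall>y\<in>cimg M i. \<forall>v. v \<noteq> 0 \<longrightarrow> 0 < gmet M i y v v)"

text \<open>The vector metrically dual to a covector; the trace of a bilinear map with respect to \<open>g\<close>
  is \<open>\<Sum>\<^sub>a\<^sub>,\<^sub>b g\<^sup>a\<^sup>b B\<^sub>a\<^sub>b\<close>, where \<open>sharp g (\<lambda>w. w \<bullet> b)\<close> is the vector with components \<open>g\<^sup>a\<^sup>b\<close>.\<close>

definition sharp :: "('e::euclidean_space \<Rightarrow> 'e \<Rightarrow> real) \<Rightarrow> ('e \<Rightarrow> real) \<Rightarrow> 'e" where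
  "sharp g \<alpha> = (THE v. \<forall>w. g v w = \<alpha> w)"

definition metric_trace ::
  "('e::euclidean_space \<Rightarrow> 'e \<Rightarrow> real) \<Rightarrow> ('e \<Rightarrow> 'e \<Rightarrow> 'f::real_vector) \<Rightarrow> 'f" where
  "metric_trace g B = (\<Sum>b\<in>Basis. B b (sharp g (\<lambda>w. w \<bullet> b)))"

text \<open>\<open>christoffel M i y v w\<close> is \<open>\<nabla>\<^sub>V W\<close> at \<open>y\<close>, by Koszul's formula, for the vector fields
  \<open>V\<close>, \<open>W\<close> with constant components \<open>v\<close>, \<open>w\<close> in chart \<open>i\<close>.\<close>

definition christoffel :: "('i, 'p, 'e::euclidean_space) rmfd \<Rightarrow> 'i \<Rightarrow> 'e \<Rightarrow> 'e \<Rightarrow> 'e \<Rightarrow> 'e" where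
  "christoffel M i y v w = sharp (gmet M i y) (\<lambda>z.
     (frechet_derivative (\<lambda>x. gmet M i x w z) (at y) v
    + frechet_derivative (\<lambda>x. gmet M i x v z) (at y) w
    - frechet_derivative (\<lambda>x. gmet M i x v w) (at y) z) / 2)"

lemma sharp_eqI:
  assumes "bilinear g" "\<And>v. (\<And>w. g v w = 0) \<Longrightarrow> v = 0" "linear \<alpha>"
  shows "g (sharp g \<alpha>) w = \<alpha> w"
proof -
  let ?L = "\<lambda>v. \<Sum>b\<in>Basis. g v b *\<^sub>R b"
  have lin: "linear (\<lambda>v. g v w)" "linear (\<lambda>w. g v w)" for v w
    using assms(1) unfolding bilinear_def by auto
  have exp: "g v w = (\<Sum>b\<in>Basis. (w \<bullet> b) * g v b)" for v w
  proof -
    have "g v w = g v (\<Sum>b\<in>Basis. (w \<bullet> b) *\<^sub>R b)" by (simp add: euclidean_representation)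
    also have "\<dots> = (\<Sum>b\<in>Basis. (w \<bullet> b) * g v b)"
      by (simp add: linear_sum[OF lin(2)] linear_cmul[OF lin(2)])
    finally show ?thesis .
  qed
  have L: "linear ?L"
    by (rule linearI)
      (simp_all add: linear_add[OF lin(1)] linear_cmul[OF lin(1)] scaleR_left_distrib
        sum.distrib scaleR_sum_right)
  have inner: "?L v \<bullet> b = g v b" if "b \<in> Basis" for v b
    using that by simp
  have "inj ?L"
  proof (subst linear_injective_0[OF L], intro allI impI)
    fix v assume "?L v = 0"
    then have *: "g v b = 0" if "b \<in> Basis" for b
      using inner[OF that, of v] by simp
    show "v = 0"
    proof (rule assms(2))
      show "g v w = 0" for w
        unfolding exp[of v w] using * by (intro sum.neutral) simp
    qed
  qed
  then have "surj ?L" using L linear_injective_imp_surjective by blast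
  from surjD[OF this, of "\<Sum>b\<in>Basis. \<alpha> b *\<^sub>R b"]
  obtain v where v: "?L v = (\<Sum>b\<in>Basis. \<alpha> b *\<^sub>R b)" by auto
  have eq: "g v w = \<alpha> w" for w
  proof -
    have gb: "g v b = \<alpha> b" if "b \<in> Basis" for b
      using inner[OF that, of v] v that by simp
    have "\<alpha> w = \<alpha> (\<Sum>b\<in>Basis. (w \<bullet> b) *\<^sub>R b)" by (simp add: euclidean_representation)
    also have "\<dots> = (\<Sum>b\<in>Basis. (w \<bullet> b) * \<alpha> b)"
      by (simp add: linear_sum[OF assms(3)] linear_cmul[OF assms(3)])
    also have "\<dots> = (\<Sum>b\<in>Basis. (w \<bullet> b) * g v b)"
      by (intro sum.cong) (simp_all add: gb)
    also have "\<dots> = g v w"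
      by (rule exp[symmetric])
    finally show ?thesis by (rule sym)
  qed
  have "sharp g \<alpha> = v"
    unfolding sharp_def
  proof (rule the_equality)
    show "\<forall>w. g v w = \<alpha> w" using eq by blast
    fix v' assume "\<forall>w. g v' w = \<alpha> w"
    then have "g (v' - v) w = 0" for w
      using eq by (simp add: linear_diff[OF lin(1)])
    then show "v' = v" using assms(2)[of "v' - v"] by simp
  qed
  then show ?thesis using eq by simp
qed

lemma gmet_christoffel:
  assumes "smooth_manifold M" "metric_tensor M" "i \<in> cidx M" "y \<in> cimg M i"
  shows "2 * gmet M i y (christoffel M i y v w) z =
      frechet_derivative (\<lambda>x. gmet M i x w z) (at y) v
    + frechet_derivative (\<lambda>x. gmet M i x v z) (at y) w
    - frechet_derivative (\<lambda>x. gmet M i x v w) (at y) z"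
proof -
  let ?g = "gmet M i" and ?D = "\<lambda>v w. frechet_derivative (\<lambda>x. gmet M i x v w) (at y)"
  have op: "open (cimg M i)" using assms(1,3) by (simp add: smooth_manifold_def)
  have bil: "bilinear (?g x)" and nd: "(\<And>w. ?g x v w = 0) \<Longrightarrow> v = 0" if "x \<in> cimg M i" for x v
    using assms(2,3) that unfolding metric_tensor_def by blast+
  have diff: "(\<lambda>x. ?g x v w) differentiable at y" for v w
  proof -
    have "C_on (Suc 0) (cimg M i) (\<lambda>x. ?g x v w)"
      using assms(2,3) unfolding metric_tensor_def smooth_on_def by blast
    then show ?thesis using assms(4) by simp
  qed
  have hd: "((\<lambda>x. ?g x v w) has_derivative ?D v w) (at y)" for v w
    using diff frechet_derivative_works by blast
  have add: "?D v (w + w') = (\<lambda>h. ?D v w h + ?D v w' h)" for v w w'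
  proof (rule has_derivative_unique[OF hd])
    show "((\<lambda>x. ?g x v (w + w')) has_derivative (\<lambda>h. ?D v w h + ?D v w' h)) (at y)"
      by (rule has_derivative_transform_within_open[OF has_derivative_add[OF hd hd] op assms(4)])
        (simp add: bilinear_radd[OF bil])
  qed
  have scale: "?D v (c *\<^sub>R w) = (\<lambda>h. c *\<^sub>R ?D v w h)" for v w c
  proof (rule has_derivative_unique[OF hd])
    show "((\<lambda>x. ?g x v (c *\<^sub>R w)) has_derivative (\<lambda>h. c *\<^sub>R ?D v w h)) (at y)"
      by (rule has_derivative_transform_within_open[OF has_derivative_scaleR_right[OF hd] op assms(4)])
        (simp add: bilinear_rmul[OF bil])
  qed
  have lin: "linear (?D v w)" for v w
    using hd has_derivative_linear by blast
  have "linear (\<lambda>z. (?D w z v + ?D v z w - ?D v w z) / 2)"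
  proof (rule linearI)
    show "(?D w (a + b) v + ?D v (a + b) w - ?D v w (a + b)) / 2 =
        (?D w a v + ?D v a w - ?D v w a) / 2 + (?D w b v + ?D v b w - ?D v w b) / 2" for a b
      unfolding add linear_add[OF lin] by (simp add: field_simps)
    show "(?D w (c *\<^sub>R a) v + ?D v (c *\<^sub>R a) w - ?D v w (c *\<^sub>R a)) / 2 =
        c *\<^sub>R ((?D w a v + ?D v a w - ?D v w a) / 2)" for c a
      unfolding scale linear_cmul[OF lin] real_scaleR_def by algebra
  qed
  note lin\<alpha> = this
  have "?g y (sharp (?g y) (\<lambda>z. (?D w z v + ?D v z w - ?D v w z) / 2)) z
      = (?D w z v + ?D v z w - ?D v w z) / 2"
    by (rule sharp_eqI[of "?g y" "\<lambda>z. (?D w z v + ?D v z w - ?D v w z) / 2" z,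
          OF bil[OF assms(4)] _ lin\<alpha>]) (rule nd[OF assms(4)])
  then show ?thesis
    unfolding christoffel_def by (simp only:) simp
qed

text \<open>The two properties characterizing the Levi-Civita connection, on coordinate fields:\<close>

lemma christoffel_torsion_free:
  assumes "smooth_manifold M" "metric_tensor M" "i \<in> cidx M" "y \<in> cimg M i"
  shows "christoffel M i y v w = christoffel M i y w v"
proof -
  have op: "open (cimg M i)" using assms(1,3) by (simp add: smooth_manifold_def)
  have "frechet_derivative (\<lambda>x. gmet M i x v w) (at y) = frechet_derivative (\<lambda>x. gmet M i x w v) (at y)"
  proof (rule frechet_derivative_transform_within_open[OF _ op assms(4)])
    have "C_on (Suc 0) (cimg M i) (\<lambda>x. gmet M i x v w)"
      using assms(2,3) unfolding metric_tensor_def smooth_on_def by blast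
    then show "(\<lambda>x. gmet M i x v w) differentiable at y" using assms(4) by simp
    show "gmet M i x v w = gmet M i x w v" if "x \<in> cimg M i" for x
      using assms(2,3) that unfolding metric_tensor_def by blast
  qed
  then show ?thesis unfolding christoffel_def by (simp add: add.commute)
qed

lemma christoffel_metric:
  assumes "smooth_manifold M" "metric_tensor M" "i \<in> cidx M" "y \<in> cimg M i"
  shows "frechet_derivative (\<lambda>x. gmet M i x v w) (at y) z =
    gmet M i y (christoffel M i y z v) w + gmet M i y v (christoffel M i y z w)"
proof -
  have op: "open (cimg M i)" using assms(1,3) by (simp add: smooth_manifold_def)
  have sym: "gmet M i x a b = gmet M i x b a" if "x \<in> cimg M i" for x a b
    using assms(2,3) that unfolding metric_tensor_def by blast
  have D: "frechet_derivative (\<lambda>x. gmet M i x a b) (at y) = frechet_derivative (\<lambda>x. gmet M i x b a) (at y)" for a b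
  proof (rule frechet_derivative_transform_within_open[OF _ op assms(4)])
    have "C_on (Suc 0) (cimg M i) (\<lambda>x. gmet M i x a b)"
      using assms(2,3) unfolding metric_tensor_def smooth_on_def by blast
    then show "(\<lambda>x. gmet M i x a b) differentiable at y" using assms(4) by simp
    show "gmet M i x a b = gmet M i x b a" if "x \<in> cimg M i" for x
      by (rule sym[OF that])
  qed
  show ?thesis
    using gmet_christoffel[OF assms, of z v w] gmet_christoffel[OF assms, of z w v]
      sym[OF assms(4), of v "christoffel M i y z w"] fun_cong[OF D[of v w], of z] by linarith
qed

text \<open>Levi-Civita derivative in direction \<open>v\<close> of the vector field with components \<open>X\<close> in chart
  \<open>i\<close>.\<close>

definition cov_deriv ::
  "('i, 'p, 'e::euclidean_space) rmfd \<Rightarrow> 'i \<Rightarrow> ('e \<Rightarrow> 'e) \<Rightarrow> 'e \<Rightarrow> 'e \<Rightarrow> 'e" where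
  "cov_deriv M i X y v = frechet_derivative X (at y) v + christoffel M i y v (X y)"

definition gradient ::
  "('i, 'p, 'e::euclidean_space) rmfd \<Rightarrow> 'i \<Rightarrow> ('p \<Rightarrow> real) \<Rightarrow> 'e \<Rightarrow> 'e" where
  "gradient M i f y = sharp (gmet M i y) (frechet_derivative (f \<circ> param M i) (at y))"

definition divergence ::
  "('i, 'p, 'e::euclidean_space) rmfd \<Rightarrow> 'i \<Rightarrow> ('e \<Rightarrow> 'e) \<Rightarrow> 'e \<Rightarrow> real" where
  "divergence M i X y = (\<Sum>b\<in>Basis. cov_deriv M i X y b \<bullet> b)"

definition laplacian :: "('i, 'p, 'e::euclidean_space) rmfd \<Rightarrow> ('p \<Rightarrow> real) \<Rightarrow> 'p \<Rightarrow> real" where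
  "laplacian M f p = (let i = chart_at M p in divergence M i (gradient M i f) (coord M i p))"

definition geodesic ::
  "('i, 'p, 'e::euclidean_space) rmfd \<Rightarrow> real set \<Rightarrow> (real \<Rightarrow> 'p) \<Rightarrow> bool" where
  "geodesic M I \<gamma> \<longleftrightarrow> continuous_map (top_of_set I) (mtop M) \<gamma> \<and>
     (\<forall>t\<in>I. \<forall>i\<in>cidx M. \<gamma> t \<in> cdom M i \<longrightarrow>
        (let c = coord M i \<circ> \<gamma>; c' = (\<lambda>s. vector_derivative c (at s))
         in c differentiable at t \<and>
            (c' has_vector_derivative - christoffel M i (c t) (c' t) (c' t)) (at t)))"

definition complete_manifold :: "('i, 'p, 'e::euclidean_space) rmfd \<Rightarrow> bool" where
  "complete_manifold M \<longleftrightarrow>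
     (\<forall>I \<gamma>. open I \<and> is_interval I \<and> I \<noteq> {} \<and> geodesic M I \<gamma> \<longrightarrow>
        (\<exists>\<gamma>'. geodesic M UNIV \<gamma>' \<and> (\<forall>t\<in>I. \<gamma>' t = \<gamma> t)))"

definition parabolic :: "('i, 'p, 'e::euclidean_space) rmfd \<Rightarrow> bool" where
  "parabolic M \<longleftrightarrow> riemannian M \<and> complete_manifold M \<and> \<not> compact_space (mtop M) \<and>
     (\<forall>f. smooth_fun M f \<and> (\<forall>p\<in>topspace (mtop M). laplacian M f p \<le> 0) \<and>
          bdd_below (f ` topspace (mtop M)) \<longrightarrow> f constant_on topspace (mtop M))"


section \<open>Spacelike hypersurfaces\<close>

text \<open>\<open>S\<close> with the pullback of the metric of \<open>N\<close> by \<open>\<psi>\<close>.\<close>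

definition induced ::
  "('i, 'p, 'e::euclidean_space) mfd \<Rightarrow> ('j, 'q, 'f::euclidean_space) rmfd \<Rightarrow> ('p \<Rightarrow> 'q)
     \<Rightarrow> ('i, 'p, 'e) rmfd" where
  "induced S N \<psi> = \<lparr>mtop = mtop S, cidx = cidx S, cdom = cdom S, coord = coord S,
     gmet = (\<lambda>i y v w.
       let j = chart_at N (\<psi> (param S i y));
           F = local_rep S N \<psi> i j;
           DF = frechet_derivative F (at y)
       in gmet N j (F y) (DF v) (DF w))\<rparr>"

definition spacelike_hypersurface ::
  "('i, 'p, 'e::euclidean_space) mfd \<Rightarrow> ('j, 'q, 'f::euclidean_space) rmfd \<Rightarrow> ('p \<Rightarrow> 'q)
     \<Rightarrow> bool" where
  "spacelike_hypersurface S N \<psi> \<longleftrightarrow> DIM('f) = DIM('e) + 1 \<and>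
     connected_manifold S \<and> immersion S N \<psi> \<and> riemannian (induced S N \<psi>)"

text \<open>\<open>II(V, W) = \<nabla>\<^sup>N\<^sub>V (d\<psi> W) - d\<psi> (\<nabla>\<^sup>S\<^sub>V W)\<close> for the vector fields \<open>V\<close>, \<open>W\<close> with constant
  components \<open>v\<close>, \<open>w\<close> in chart \<open>i\<close> of \<open>S\<close>; the value is expressed in chart \<open>j\<close> of \<open>N\<close>.\<close>

definition second_ff ::
  "('i, 'p, 'e::euclidean_space) mfd \<Rightarrow> ('j, 'q, 'f::euclidean_space) rmfd \<Rightarrow> ('p \<Rightarrow> 'q)
     \<Rightarrow> 'i \<Rightarrow> 'j \<Rightarrow> 'e \<Rightarrow> 'e \<Rightarrow> 'e \<Rightarrow> 'f" where
  "second_ff S N \<psi> i j y v w =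
     (let F = local_rep S N \<psi> i j; DF = (\<lambda>x. frechet_derivative F (at x))
      in frechet_derivative (\<lambda>x. DF x w) (at y) v + christoffel N j (F y) (DF y v) (DF y w)
         - DF y (christoffel (induced S N \<psi>) i y v w))"

definition mean_curvature_vector ::
  "('i, 'p, 'e::euclidean_space) mfd \<Rightarrow> ('j, 'q, 'f::euclidean_space) rmfd \<Rightarrow> ('p \<Rightarrow> 'q)
     \<Rightarrow> 'i \<Rightarrow> 'j \<Rightarrow> 'e \<Rightarrow> 'f" where
  "mean_curvature_vector S N \<psi> i j y =
     (1 / real DIM('e)) *\<^sub>R metric_trace (gmet (induced S N \<psi>) i y) (second_ff S N \<psi> i j y)"

text \<open>The unit timelike normal at \<open>y\<close> that has negative product with the vector field on \<open>N\<close>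
  with components \<open>T j\<close> in chart \<open>j\<close>.\<close>

definition unit_normal ::
  "('i, 'p, 'e::euclidean_space) mfd \<Rightarrow> ('j, 'q, 'f::euclidean_space) rmfd \<Rightarrow> ('p \<Rightarrow> 'q)
     \<Rightarrow> ('j \<Rightarrow> 'f \<Rightarrow> 'f) \<Rightarrow> 'i \<Rightarrow> 'j \<Rightarrow> 'e \<Rightarrow> 'f" where
  "unit_normal S N \<psi> T i j y =
     (let F = local_rep S N \<psi> i j; g = gmet N j (F y)
      in THE \<nu>. (\<forall>w. g \<nu> (frechet_derivative F (at y) w) = 0) \<and> g \<nu> \<nu> = -1 \<and>
                g \<nu> (T j (F y)) < 0)"

definition mean_curvature ::
  "('i, 'p, 'e::euclidean_space) mfd \<Rightarrow> ('j, 'q, 'f::euclidean_space) rmfd \<Rightarrow> ('p \<Rightarrow> 'q)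
     \<Rightarrow> ('j \<Rightarrow> 'f \<Rightarrow> 'f) \<Rightarrow> 'p \<Rightarrow> real" where
  "mean_curvature S N \<psi> T p =
     (let i = chart_at S p; j = chart_at N (\<psi> p); y = coord S i p
      in THE h. mean_curvature_vector S N \<psi> i j y = h *\<^sub>R unit_normal S N \<psi> T i j y)"


section \<open>Plane fronted waves\<close>

text \<open>Points of \<open>\<real>\<^sup>2 \<times> M\<close> are \<open>((u, v), x)\<close>; the charts are \<open>id \<times> coord M i\<close>.\<close>

definition plane_wave ::
  "('i, 'm, 'e::euclidean_space) rmfd \<Rightarrow> (real \<Rightarrow> 'm \<Rightarrow> real)
     \<Rightarrow> ('i, (real \<times> real) \<times> 'm, (real \<times> real) \<times> 'e) rmfd" where
  "plane_wave M \<H> = \<lparr>mtop = prod_topology euclidean (mtop M), cidx = cidx M,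
     cdom = (\<lambda>i. UNIV \<times> cdom M i),
     coord = (\<lambda>i (uv, x). (uv, coord M i x)),
     gmet = (\<lambda>i ((u, v), y) ((a, b), w) ((a', b'), w').
       \<H> u (param M i y) * a * a' + a * b' + b * a' + gmet M i y w w')\<rparr>"

definition plane_fronted_wave ::
  "('i, 'm, 'e::euclidean_space) rmfd \<Rightarrow> (real \<Rightarrow> 'm \<Rightarrow> real) \<Rightarrow> bool" where
  "plane_fronted_wave M \<H> \<longleftrightarrow> connected_manifold M \<and> riemannian M \<and>
     smooth_fun (plane_wave M \<H>) (\<lambda>((u, v), x). \<H> u x)"

definition u_coord :: "(real \<times> real) \<times> 'm \<Rightarrow> real" where
  "u_coord = (\<lambda>((u, v), x). u)"

definition d_v :: "'i \<Rightarrow> (real \<times> real) \<times> 'e::euclidean_space \<Rightarrow> (real \<times> real) \<times> 'e" where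
  "d_v i y = ((0, 1), 0)"

end

theory Submission
  imports Defs
begin

text \<open>The Laplacian of \<open>\<mu> = u \<circ> \<psi>\<close> is the mean curvature times a negative function, and \<open>\<mu>\<close> is never
  constant. The gradient of \<open>u\<close> in the wave is \<open>\<partial>\<^sub>v\<close>, because
  \<open>\<langle>X, \<partial>\<^sub>v\<rangle> = du(X)\<close>, and \<open>\<partial>\<^sub>v\<close> is parallel. Hence the Hessian of \<open>\<mu>\<close> for the induced metric is
  \<open>(X, Y) \<mapsto> \<langle>II(X, Y), \<partial>\<^sub>v\<rangle>\<close>, and tracing it gives \<open>\<Delta>\<mu> = (n + 1) H \<langle>N, \<partial>\<^sub>v\<rangle>\<close>
  (\<open>laplacian_u_coord\<close>). Since \<open>\<langle>N, \<partial>\<^sub>v\<rangle> < 0\<close>, the function \<open>\<mu>\<close> is superharmonic if \<open>H \<ge> 0\<close>, and \<open>-\<mu>\<close>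
  is superharmonic if \<open>H \<le> 0\<close>. Under the respective bound on \<open>\<mu>\<close>, parabolicity forces \<open>\<mu>\<close> to be constant.

  But \<open>d\<mu>\<close> vanishes nowhere (\<open>u_coord_not_constant\<close>): at a zero, \<open>\<partial>\<^sub>v\<close> would be orthogonal to the
  tangent hyperplane. As a lightlike vector it does not lie in that hyperplane, on which the metric is
  positive definite, so together they span the whole tangent space. Being orthogonal to itself too,
  \<open>\<partial>\<^sub>v\<close> would be orthogonal to everything, against nondegeneracy (\<open>lightlike_not_normal\<close>).

  Everything is computed in charts. The facts of Riemannian geometry behind this argument are proved here for
  that representation: the symmetry of second derivatives (\<open>symmetric_second_derivative\<close>), the
  Laplacian as the trace of the covariant Hessian (\<open>divergence_gradient\<close>), the independence of the
  induced metric of the chart of the ambient manifold (\<open>gmet_induced\<close>), and Gauss's formula, by which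
  \<open>II\<close> takes normal values (\<open>second_ff_normal\<close>). The last one is what makes the definition of \<open>H\<close> by
  \<open>II\<close> and \<open>N\<close> meaningful (\<open>mean_curvature_vector_eq\<close>).\<close>

section \<open>Calculus of smooth maps\<close>

lemma C_on_cong:
  assumes "open S" "\<And>x. x \<in> S \<Longrightarrow> f x = g x" "C_on k S f"
  shows "C_on k S g"
  using assms(2,3)
proof (induction k arbitrary: f g)
  case 0
  then show ?case using continuous_on_cong[of S S f g] by simp
next
  case (Suc k)
  have d: "(g has_derivative frechet_derivative f (at x)) (at x)" if "x \<in> S" for x
    by (rule has_derivative_transform_within_open[OF _ assms(1) that, of f])
      (use Suc.prems that in \<open>simp_all add: frechet_derivative_works[symmetric]\<close>)
  have eq: "frechet_derivative f (at x) = frechet_derivative g (at x)" if "x \<in> S" for x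
    by (rule frechet_derivative_at[OF d[OF that]])
  have "C_on k S (\<lambda>x. frechet_derivative g (at x) v)" for v
    using Suc.IH[of "\<lambda>x. frechet_derivative f (at x) v" "\<lambda>x. frechet_derivative g (at x) v"]
      eq Suc.prems by simp
  moreover have "g differentiable at x" if "x \<in> S" for x
    using d[OF that] by (rule differentiableI)
  ultimately show ?case by simp
qed

text \<open>Smoothness is a local property, so for a map on a whole chart it may be checked on the smaller sets
  on which a target chart is available.\<close>

lemma C_on_locally:
  assumes "\<And>x. x \<in> S \<Longrightarrow> \<exists>U. open U \<and> x \<in> U \<and> C_on k U f"
  shows "C_on k S f"
  using assms
proof (induction k arbitrary: f)
  case 0
  then show ?case
    by (force simp: continuous_on_eq_continuous_at intro!: continuous_at_imp_continuous_on)
next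
  case (Suc k)
  have "f differentiable at x" if "x \<in> S" for x
    using Suc.prems[OF that] by auto
  moreover have "C_on k S (\<lambda>x. frechet_derivative f (at x) v)" for v
    by (rule Suc.IH) (use Suc.prems in force)
  ultimately show ?case by simp
qed

lemma C_on_const: "C_on k S (\<lambda>x. c)"
  by (induction k arbitrary: c) simp_all

lemma C_on_linear:
  fixes l :: "'a::euclidean_space \<Rightarrow> 'b::real_normed_vector"
  assumes "linear l"
  shows "C_on k S l"
proof (cases k)
  case 0
  then show ?thesis using assms linear_continuous_on linear_conv_bounded_linear by auto
next
  case (Suc m)
  have d: "(l has_derivative l) (at x)" for x
    using assms linear_conv_bounded_linear bounded_linear_imp_has_derivative by blast
  have "frechet_derivative l (at x) = l" for x
    using frechet_derivative_at[OF d] by simp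
  then show ?thesis using differentiableI[OF d] Suc by (simp add: C_on_const)
qed

lemma C_on_add:
  assumes "open S" "C_on k S f" "C_on k S g"
  shows "C_on k S (\<lambda>x. f x + g x)"
  using assms(2,3)
proof (induction k arbitrary: f g)
  case 0
  then show ?case by (simp add: continuous_on_add)
next
  case (Suc k)
  have "C_on k S (\<lambda>x. frechet_derivative (\<lambda>x. f x + g x) (at x) v)" for v
  proof (rule C_on_cong[OF assms(1) _ Suc.IH[of "\<lambda>x. frechet_derivative f (at x) v"
          "\<lambda>x. frechet_derivative g (at x) v"]])
    fix x assume "x \<in> S"
    then have "(f has_derivative frechet_derivative f (at x)) (at x)"
      "(g has_derivative frechet_derivative g (at x)) (at x)"
      using Suc.prems by (simp_all add: frechet_derivative_works[symmetric])
    then have "((\<lambda>x. f x + g x) has_derivative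
        (\<lambda>h. frechet_derivative f (at x) h + frechet_derivative g (at x) h)) (at x)"
      by (rule has_derivative_add)
    from fun_cong[OF frechet_derivative_at[OF this], of v]
    show "frechet_derivative f (at x) v + frechet_derivative g (at x) v =
        frechet_derivative (\<lambda>x. f x + g x) (at x) v" .
  qed (use Suc.prems in simp_all)
  moreover have "(\<lambda>x. f x + g x) differentiable at x" if "x \<in> S" for x
    using Suc.prems that by (simp add: differentiable_add)
  ultimately show ?case by simp
qed

lemma has_derivative_linear_comp:
  fixes l :: "'b::euclidean_space \<Rightarrow> 'c::real_normed_vector"
  assumes "linear l" "(f has_derivative f') F"
  shows "((\<lambda>x. l (f x)) has_derivative (\<lambda>h. l (f' h))) F"
  by (rule bounded_linear.has_derivative[OF assms(1)[unfolded linear_conv_bounded_linear] assms(2)])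

lemma frechet_derivative_linear_comp:
  fixes l :: "'b::euclidean_space \<Rightarrow> 'c::real_normed_vector"
  assumes "linear l" "f differentiable at x"
  shows "frechet_derivative (\<lambda>x. l (f x)) (at x) v = l (frechet_derivative f (at x) v)"
  using fun_cong[OF frechet_derivative_at[OF has_derivative_linear_comp[OF assms(1)
      assms(2)[unfolded frechet_derivative_works]]]] by simp

lemma C_on_linear_comp:
  fixes l :: "'b::euclidean_space \<Rightarrow> 'c::real_normed_vector"
  assumes "open S" "linear l" "C_on k S f"
  shows "C_on k S (\<lambda>x. l (f x))"
  using assms(3)
proof (induction k arbitrary: f)
  case 0
  then show ?case
    using bounded_linear.continuous_on[OF assms(2)[unfolded linear_conv_bounded_linear]] by simp
next
  case (Suc k)
  have "C_on k S (\<lambda>x. frechet_derivative (\<lambda>x. l (f x)) (at x) v)" for v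
    by (rule C_on_cong[OF assms(1) _ Suc.IH[of "\<lambda>x. frechet_derivative f (at x) v"]])
      (use Suc.prems frechet_derivative_linear_comp[OF assms(2), of f] in auto)
  moreover have "(\<lambda>x. l (f x)) differentiable at x" if "x \<in> S" for x
    using Suc.prems that
    by (intro differentiableI[OF has_derivative_linear_comp[OF assms(2),
          of f "frechet_derivative f (at x)"]])
      (simp add: frechet_derivative_works[symmetric])
  ultimately show ?case by simp
qed

lemma C_on_comp_linear:
  fixes l :: "'a::euclidean_space \<Rightarrow> 'b::euclidean_space"
  assumes "open S" "linear l" "C_on k S f"
  shows "C_on k (l -` S) (\<lambda>x. f (l x))"
  using assms(3)
proof (induction k arbitrary: f)
  case 0
  then show ?case
    using continuous_on_compose2[of S f "l -` S" l]
      linear_continuous_on[OF assms(2)[unfolded linear_conv_bounded_linear]] by auto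
next
  case (Suc k)
  have op: "open (l -` S)"
    by (rule open_vimage[OF assms(1) linear_continuous_on[OF
          assms(2)[unfolded linear_conv_bounded_linear]]])
  have d: "((\<lambda>x. f (l x)) has_derivative (\<lambda>v. frechet_derivative f (at (l x)) (l v))) (at x)"
    if "l x \<in> S" for x
    using has_derivative_compose[of l l x UNIV f "frechet_derivative f (at (l x))"]
      bounded_linear_imp_has_derivative[OF assms(2)[unfolded linear_conv_bounded_linear]]
      Suc.prems that
    by (simp add: frechet_derivative_works[symmetric])
  have "C_on k (l -` S) (\<lambda>x. frechet_derivative (\<lambda>x. f (l x)) (at x) v)" for v
  proof (rule C_on_cong[OF op _ Suc.IH[of "\<lambda>x. frechet_derivative f (at x) (l v)"]])
    show "frechet_derivative f (at (l x)) (l v) = frechet_derivative (\<lambda>x. f (l x)) (at x) v"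
      if "x \<in> l -` S" for x
      using fun_cong[OF frechet_derivative_at[OF d[of x]]] that by auto
    show "C_on k S (\<lambda>x. frechet_derivative f (at x) (l v))" using Suc.prems by simp
  qed
  moreover have "(\<lambda>x. f (l x)) differentiable at x" if "x \<in> l -` S" for x
    using d[of x] that differentiableI by auto
  ultimately show ?case by simp
qed

lemma smooth_onD:
  assumes "smooth_on S f" "x \<in> S"
  shows "f differentiable at x" "(\<lambda>x. frechet_derivative f (at x) v) differentiable at x"
  using assms(1)[unfolded smooth_on_def, rule_format, of "Suc (Suc 0)"] assms(2) by auto

text \<open>The mean value theorem, applied first along \<open>v\<close> to the difference between \<open>f\<close> and its translate
  by \<open>t w\<close>, and then along \<open>w\<close>. The second difference on the left does not change when \<open>v\<close> and \<open>w\<close> are exchanged.\<close>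

lemma second_difference_mean_value:
  fixes f :: "'a::euclidean_space \<Rightarrow> real"
  assumes C: "C_on (Suc (Suc 0)) S f" and t: "0 < t"
    and S: "\<And>s r. 0 \<le> s \<Longrightarrow> s \<le> t \<Longrightarrow> 0 \<le> r \<Longrightarrow> r \<le> t \<Longrightarrow> y + s *\<^sub>R v + r *\<^sub>R w \<in> S"
  shows "\<exists>s r. 0 < s \<and> s < t \<and> 0 < r \<and> r < t \<and>
     f (y + t *\<^sub>R v + t *\<^sub>R w) - f (y + t *\<^sub>R v) - f (y + t *\<^sub>R w) + f y =
     t * t * frechet_derivative (\<lambda>x. frechet_derivative f (at x) v) (at (y + s *\<^sub>R v + r *\<^sub>R w)) w"
proof -
  let ?D = "\<lambda>x. frechet_derivative f (at x)"
  let ?P = "\<lambda>x. frechet_derivative (\<lambda>x. ?D x v) (at x)"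
  have D: "(f has_derivative ?D x) (at x)" and P: "((\<lambda>x. ?D x v) has_derivative ?P x) (at x)"
    if "x \<in> S" for x
    using C that by (simp_all add: frechet_derivative_works[symmetric])
  have lin: "?D x (a *\<^sub>R h) = a * ?D x h" "?P x (a *\<^sub>R h) = a * ?P x h" if "x \<in> S" for x a h
    using has_derivative_linear[OF D[OF that]] has_derivative_linear[OF P[OF that]]
    by (simp_all add: linear_cmul)
  have d1: "((\<lambda>s. f (y + s *\<^sub>R v + r *\<^sub>R w)) has_real_derivative ?D (y + s *\<^sub>R v + r *\<^sub>R w) v) (at s)"
    if "0 \<le> s" "s \<le> t" "0 \<le> r" "r \<le> t" for s r
  proof -
    have "((\<lambda>s. y + s *\<^sub>R v + r *\<^sub>R w) has_derivative (\<lambda>h. h *\<^sub>R v)) (at s)"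
      by (auto intro!: derivative_eq_intros)
    from has_derivative_compose[OF this D[OF S[OF that]]] show ?thesis
      unfolding has_field_derivative_def
      by (rule has_derivative_eq_rhs) (simp add: lin[OF S[OF that]] fun_eq_iff)
  qed
  have "((\<lambda>s. f (y + s *\<^sub>R v + t *\<^sub>R w) - f (y + s *\<^sub>R v + 0 *\<^sub>R w)) has_real_derivative
      ?D (y + s *\<^sub>R v + t *\<^sub>R w) v - ?D (y + s *\<^sub>R v + 0 *\<^sub>R w) v) (at s)"
    if "0 \<le> s" "s \<le> t" for s
    using that t by (intro DERIV_diff d1) auto
  from MVT2[OF t this] obtain s where s: "0 < s" "s < t" and
    e1: "f (y + t *\<^sub>R v + t *\<^sub>R w) - f (y + t *\<^sub>R v) - (f (y + t *\<^sub>R w) - f y)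
      = t * (?D (y + s *\<^sub>R v + t *\<^sub>R w) v - ?D (y + s *\<^sub>R v) v)"
    by auto
  have "((\<lambda>r. ?D (y + s *\<^sub>R v + r *\<^sub>R w) v) has_real_derivative ?P (y + s *\<^sub>R v + r *\<^sub>R w) w) (at r)"
    if "0 \<le> r" "r \<le> t" for r
  proof -
    have in': "y + s *\<^sub>R v + r *\<^sub>R w \<in> S" using S s that by simp
    have "((\<lambda>r. y + s *\<^sub>R v + r *\<^sub>R w) has_derivative (\<lambda>h. h *\<^sub>R w)) (at r)"
      by (auto intro!: derivative_eq_intros)
    from has_derivative_compose[OF this P[OF in']] show ?thesis
      unfolding has_field_derivative_def
      by (rule has_derivative_eq_rhs) (simp add: lin[OF in'] fun_eq_iff)
  qed
  from MVT2[OF t this] obtain r where r: "0 < r" "r < t" and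
    "?D (y + s *\<^sub>R v + t *\<^sub>R w) v - ?D (y + s *\<^sub>R v) v = t * ?P (y + s *\<^sub>R v + r *\<^sub>R w) w"
    by auto
  with e1 s show ?thesis by (intro exI[of _ s] exI[of _ r]) simp
qed

text \<open>The second difference over a small parallelogram equals \<open>t\<^sup>2\<close> times a value of either mixed derivative
  near \<open>y\<close>. So the two mixed derivatives have common values arbitrarily close to \<open>y\<close>, and continuity
  makes them equal at \<open>y\<close>.\<close>

lemma symmetric_second_derivative_real:
  fixes f :: "'a::euclidean_space \<Rightarrow> real"
  assumes C: "C_on (Suc (Suc 0)) S f" and op: "open S" and y: "y \<in> S"
  shows "frechet_derivative (\<lambda>x. frechet_derivative f (at x) v) (at y) w =
         frechet_derivative (\<lambda>x. frechet_derivative f (at x) w) (at y) v" (is "?P y = ?Q y")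
proof (rule ccontr)
  assume ne: "?P y \<noteq> ?Q y"
  define e where "e = \<bar>?P y - ?Q y\<bar> / 2"
  have e: "e > 0" using ne by (simp add: e_def)
  have "isCont ?P y" "isCont ?Q y"
    using C op y by (auto simp: continuous_on_eq_continuous_at)
  then have "\<exists>d>0. \<forall>x. dist x y < d \<longrightarrow> dist (?P x) (?P y) < e"
    "\<exists>d>0. \<forall>x. dist x y < d \<longrightarrow> dist (?Q x) (?Q y) < e"
    using e unfolding continuous_at_eps_delta by auto
  then obtain d1 d2 where d: "d1 > 0" "d2 > 0"
    "\<And>x. dist x y < d1 \<Longrightarrow> dist (?P x) (?P y) < e" "\<And>x. dist x y < d2 \<Longrightarrow> dist (?Q x) (?Q y) < e"
    by auto
  obtain d0 where d0: "d0 > 0" "ball y d0 \<subseteq> S" using op y openE by blast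
  define \<delta> where "\<delta> = min d0 (min d1 d2)"
  have \<delta>: "\<delta> > 0" using d d0 by (simp add: \<delta>_def)
  \<comment> \<open>With this side length all corners stay within \<open>\<delta>\<close> of \<open>y\<close>.\<close>
  define t where "t = \<delta> / (norm v + norm w + 1)"
  have n: "norm v + norm w + 1 > 0" by (smt (verit) norm_ge_zero)
  have t: "t > 0" using \<delta> n by (simp add: t_def)
  have near: "dist (y + s *\<^sub>R a + r *\<^sub>R b) y < \<delta>"
    if "0 \<le> s" "s \<le> t" "0 \<le> r" "r \<le> t" "(a, b) = (v, w) \<or> (a, b) = (w, v)" for s r a b
  proof -
    have "dist (y + s *\<^sub>R a + r *\<^sub>R b) y = norm (s *\<^sub>R a + r *\<^sub>R b)" by (simp add: dist_norm)
    also have "\<dots> \<le> s * norm a + r * norm b"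
      using norm_triangle_ineq[of "s *\<^sub>R a" "r *\<^sub>R b"] that by simp
    also have "\<dots> \<le> t * norm a + t * norm b"
      using that by (intro add_mono mult_right_mono) auto
    also have "\<dots> < t * (norm v + norm w + 1)"
      using t that(5) by (auto simp: algebra_simps)
    also have "\<dots> = \<delta>" using n by (simp add: t_def)
    finally show ?thesis .
  qed
  have inS: "y + s *\<^sub>R a + r *\<^sub>R b \<in> S"
    if "0 \<le> s" "s \<le> t" "0 \<le> r" "r \<le> t" "(a, b) = (v, w) \<or> (a, b) = (w, v)" for s r a b
    using near[OF that] d0(2) by (auto simp: \<delta>_def dist_commute subset_iff)
  obtain s r where 1: "0 < s" "s < t" "0 < r" "r < t" and e1:
    "f (y + t *\<^sub>R v + t *\<^sub>R w) - f (y + t *\<^sub>R v) - f (y + t *\<^sub>R w) + f y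
      = t * t * ?P (y + s *\<^sub>R v + r *\<^sub>R w)"
    using second_difference_mean_value[OF C t, of y v w] inS by blast
  obtain s' r' where 2: "0 < s'" "s' < t" "0 < r'" "r' < t" and e2:
    "f (y + t *\<^sub>R w + t *\<^sub>R v) - f (y + t *\<^sub>R w) - f (y + t *\<^sub>R v) + f y
      = t * t * ?Q (y + s' *\<^sub>R w + r' *\<^sub>R v)"
    using second_difference_mean_value[OF C t, of y w v] inS by blast
  have "t * t * ?P (y + s *\<^sub>R v + r *\<^sub>R w) = t * t * ?Q (y + s' *\<^sub>R w + r' *\<^sub>R v)"
    unfolding e1[symmetric] e2[symmetric] by (simp add: add_ac)
  then have "?P (y + s *\<^sub>R v + r *\<^sub>R w) = ?Q (y + s' *\<^sub>R w + r' *\<^sub>R v)" using t by simp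
  moreover have "dist (?P (y + s *\<^sub>R v + r *\<^sub>R w)) (?P y) < e"
    using near[of s r v w] 1 by (intro d) (auto simp: \<delta>_def)
  moreover have "dist (?Q (y + s' *\<^sub>R w + r' *\<^sub>R v)) (?Q y) < e"
    using near[of s' r' w v] 2 by (intro d) (auto simp: \<delta>_def)
  ultimately show False unfolding e_def dist_real_def by (auto simp: field_simps abs_if split: if_splits)
qed

lemma symmetric_second_derivative:
  fixes f :: "'a::euclidean_space \<Rightarrow> 'b::euclidean_space"
  assumes sm: "smooth_on S f" and op: "open S" and y: "y \<in> S"
  shows "frechet_derivative (\<lambda>x. frechet_derivative f (at x) v) (at y) w =
         frechet_derivative (\<lambda>x. frechet_derivative f (at x) w) (at y) v"
proof (rule euclidean_eqI)
  fix b :: 'b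
  have lb: "linear (\<lambda>x. x \<bullet> b)"
    by (simp add: bounded_linear.linear bounded_linear_inner_left)
  have *: "frechet_derivative (\<lambda>x. frechet_derivative (\<lambda>x. f x \<bullet> b) (at x) v) (at y) w
       = frechet_derivative (\<lambda>x. frechet_derivative f (at x) v) (at y) w \<bullet> b" for v w
  proof -
    have "frechet_derivative (\<lambda>x. frechet_derivative f (at x) v \<bullet> b) (at y)
       = frechet_derivative (\<lambda>x. frechet_derivative (\<lambda>x. f x \<bullet> b) (at x) v) (at y)"
      by (rule frechet_derivative_transform_within_open[OF _ op y])
        (use smooth_onD[OF sm] y frechet_derivative_linear_comp[OF lb, of f] in auto)
    from fun_cong[OF this, of w] show ?thesis
      using frechet_derivative_linear_comp[OF lb smooth_onD(2)[OF sm y], of v w] by simp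
  qed
  show "frechet_derivative (\<lambda>x. frechet_derivative f (at x) v) (at y) w \<bullet> b =
        frechet_derivative (\<lambda>x. frechet_derivative f (at x) w) (at y) v \<bullet> b"
    using symmetric_second_derivative_real[OF C_on_linear_comp[OF op lb
          sm[unfolded smooth_on_def, rule_format]] op y, of v w]
    unfolding * .
qed


section \<open>Charts and metrics\<close>

lemma coord_param:
  assumes "y \<in> cimg M i"
  shows "param M i y \<in> cdom M i" "coord M i (param M i y) = y"
  using assms unfolding cimg_def param_def by (auto intro: inv_into_into f_inv_into_f)

lemma cdom_subset_topspace:
  assumes "smooth_manifold M" "i \<in> cidx M"
  shows "cdom M i \<subseteq> topspace (mtop M)"
  using assms openin_subset unfolding smooth_manifold_def by blast

lemma open_cimg:
  assumes "smooth_manifold M" "i \<in> cidx M"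
  shows "open (cimg M i)"
  using assms unfolding smooth_manifold_def by blast

lemma homeomorphic_coord:
  assumes "smooth_manifold M" "i \<in> cidx M"
  shows "homeomorphic_map (subtopology (mtop M) (cdom M i)) (top_of_set (cimg M i)) (coord M i)"
  using assms unfolding smooth_manifold_def by blast

lemma inj_on_coord:
  assumes "smooth_manifold M" "i \<in> cidx M"
  shows "inj_on (coord M i) (cdom M i)"
  using homeomorphic_imp_injective_map[OF homeomorphic_coord[OF assms]]
    cdom_subset_topspace[OF assms] by (simp add: inf.absorb2)

lemma param_coord:
  assumes "smooth_manifold M" "i \<in> cidx M" "p \<in> cdom M i"
  shows "param M i (coord M i p) = p"
  using inj_on_coord[OF assms(1,2)] assms(3) by (simp add: param_def)

lemma chart_at:
  assumes "smooth_manifold M" "p \<in> topspace (mtop M)"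
  shows "chart_at M p \<in> cidx M" "p \<in> cdom M (chart_at M p)"
proof -
  have "\<exists>i. i \<in> cidx M \<and> p \<in> cdom M i"
    using assms unfolding smooth_manifold_def by blast
  from someI_ex[OF this] show "chart_at M p \<in> cidx M" "p \<in> cdom M (chart_at M p)"
    by (auto simp: chart_at_def)
qed

lemma open_coord_image:
  assumes "smooth_manifold M" "i \<in> cidx M" "openin (mtop M) U" "U \<subseteq> cdom M i"
  shows "open (coord M i ` U)"
proof -
  have "openin (subtopology (mtop M) (cdom M i)) U"
    using assms(3,4) by (auto simp: openin_subtopology)
  then have "openin (top_of_set (cimg M i)) (coord M i ` U)"
    using homeomorphic_imp_open_map[OF homeomorphic_coord[OF assms(1,2)]]
    by (simp add: open_map_def)
  then show ?thesis
    using open_cimg[OF assms(1,2)] by (simp add: openin_open_eq)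
qed

lemma open_chart_overlap:
  assumes "smooth_manifold M" "i \<in> cidx M" "smooth_manifold N" "j \<in> cidx N"
    "continuous_map (mtop M) (mtop N) f"
  shows "open (coord M i ` (cdom M i \<inter> f -` cdom N j))"
proof (rule open_coord_image[OF assms(1,2)])
  have o: "openin (mtop M) (cdom M i)" "openin (mtop N) (cdom N j)"
    using assms unfolding smooth_manifold_def by blast+
  have "cdom M i \<inter> f -` cdom N j = cdom M i \<inter> {p \<in> topspace (mtop M). f p \<in> cdom N j}"
    using cdom_subset_topspace[OF assms(1,2)] by blast
  then show "openin (mtop M) (cdom M i \<inter> f -` cdom N j)"
    using openin_Int[OF o(1) openin_continuous_map_preimage[OF assms(5) o(2)]] by simp
qed auto

lemma open_overlap:
  assumes "smooth_manifold M" "i \<in> cidx M" "j \<in> cidx M"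
  shows "open (coord M i ` (cdom M i \<inter> cdom M j))"
  using open_chart_overlap[OF assms(1,2,1,3), of id] by simp

lemma smooth_transition:
  assumes "smooth_manifold M" "i \<in> cidx M" "j \<in> cidx M"
  shows "smooth_on (coord M i ` (cdom M i \<inter> cdom M j)) (local_rep M M id i j)"
  using assms unfolding smooth_manifold_def by blast

lemma param_transition:
  assumes "smooth_manifold M" "i \<in> cidx M" "j \<in> cidx M" "y \<in> coord M i ` (cdom M i \<inter> cdom M j)"
  shows "param M j (local_rep M M id i j y) = param M i y"
proof -
  obtain p where "p \<in> cdom M i" "p \<in> cdom M j" "y = coord M i p" using assms(4) by blast
  then show ?thesis
    using param_coord[OF assms(1,2)] param_coord[OF assms(1,3)] by (simp add: local_rep_def)
qed

lemma bilinear_gmet: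
  assumes "metric_tensor M" "i \<in> cidx M" "y \<in> cimg M i"
  shows "bilinear (gmet M i y)" "gmet M i y v w = gmet M i y w v"
    "(\<And>w. gmet M i y v w = 0) \<Longrightarrow> v = 0"
  using assms unfolding metric_tensor_def by blast+

lemma smooth_gmet:
  assumes "metric_tensor M" "i \<in> cidx M"
  shows "smooth_on (cimg M i) (\<lambda>y. gmet M i y v w)"
  using assms unfolding metric_tensor_def by blast

lemma gmet_transition:
  assumes "metric_tensor M" "i \<in> cidx M" "j \<in> cidx M" "y \<in> coord M i ` (cdom M i \<inter> cdom M j)"
  shows "gmet M i y v w = gmet M j (local_rep M M id i j y)
    (frechet_derivative (local_rep M M id i j) (at y) v)
    (frechet_derivative (local_rep M M id i j) (at y) w)"
  using assms unfolding metric_tensor_def Let_def by blast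


section \<open>The plane fronted wave as a Lorentzian manifold\<close>

lemma second_countable_prod_topology:
  assumes "second_countable X" "second_countable Y"
  shows "second_countable (prod_topology X Y)"
proof -
  obtain B where B: "countable B" "\<forall>V\<in>B. openin X V"
    "\<forall>U x. openin X U \<and> x \<in> U \<longrightarrow> (\<exists>V \<in> B. x \<in> V \<and> V \<subseteq> U)"
    using assms(1) unfolding second_countable_def by (elim exE conjE)
  obtain C where C: "countable C" "\<forall>V\<in>C. openin Y V"
    "\<forall>U x. openin Y U \<and> x \<in> U \<longrightarrow> (\<exists>V \<in> C. x \<in> V \<and> V \<subseteq> U)"
    using assms(2) unfolding second_countable_def by (elim exE conjE)
  let ?D = "(\<lambda>(V, W). V \<times> W) ` (B \<times> C)"
  have "\<exists>V\<in>?D. x \<in> V \<and> V \<subseteq> U" if U: "openin (prod_topology X Y) U" "x \<in> U" for U x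
  proof -
    obtain a b where x: "x = (a, b)" by (cases x)
    obtain V W where VW: "openin X V" "openin Y W" "a \<in> V" "b \<in> W" "V \<times> W \<subseteq> U"
      using U(1)[unfolded openin_prod_topology_alt, rule_format, of a b] U(2)[unfolded x] by blast
    obtain V' where V': "V' \<in> B" "a \<in> V'" "V' \<subseteq> V" using B(3) VW(1,3) by blast
    obtain W' where W': "W' \<in> C" "b \<in> W'" "W' \<subseteq> W" using C(3) VW(2,4) by blast
    have "V' \<times> W' \<subseteq> V \<times> W" using V' W' by (intro Sigma_mono)
    show ?thesis
    proof (rule bexI[of _ "V' \<times> W'"])
      show "x \<in> V' \<times> W' \<and> V' \<times> W' \<subseteq> U"
        using V' W' VW(5) \<open>V' \<times> W' \<subseteq> V \<times> W\<close> by (simp add: x)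
      show "V' \<times> W' \<in> ?D" using V'(1) W'(1) by force
    qed
  qed
  moreover have "countable ?D"
    using B(1) C(1) by (intro countable_image countable_SIGMA)
  moreover have "\<forall>V\<in>?D. openin (prod_topology X Y) V"
    using B(2) C(2) by (auto simp: openin_prod_Times_iff)
  ultimately show ?thesis unfolding second_countable_def by (intro exI[of _ ?D]) simp
qed

lemma second_countable_euclidean:
  "second_countable (euclidean :: 'a::second_countable_topology topology)"
proof -
  obtain B :: "'a set set" where B: "countable B" "topological_basis B" using ex_countable_basis by auto
  have "\<forall>V\<in>B. openin euclidean V"
    using topological_basis_open[OF B(2)] by simp
  moreover have "\<forall>U x. openin euclidean U \<and> x \<in> U \<longrightarrow> (\<exists>V\<in>B. x \<in> V \<and> V \<subseteq> U)"
    using topological_basisE[OF B(2)] by (metis open_openin)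
  ultimately show ?thesis
    unfolding second_countable_def using B(1) by (intro exI[of _ B]) simp
qed

lemma plane_wave_simps [simp]:
  "mtop (plane_wave M \<H>) = prod_topology euclidean (mtop M)"
  "cidx (plane_wave M \<H>) = cidx M"
  "cdom (plane_wave M \<H>) i = UNIV \<times> cdom M i"
  "coord (plane_wave M \<H>) i z = (fst z, coord M i (snd z))"
  "cimg (plane_wave M \<H>) i = UNIV \<times> cimg M i"
  by (auto simp: plane_wave_def cimg_def case_prod_beta image_iff)

lemma gmet_plane_wave:
  "gmet (plane_wave M \<H>) i z V W =
     \<H> (fst (fst z)) (param M i (snd z)) * fst (fst V) * fst (fst W) + fst (fst V) * snd (fst W)
     + snd (fst V) * fst (fst W) + gmet M i (snd z) (snd V) (snd W)"
  by (simp add: plane_wave_def case_prod_beta)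

lemma param_plane_wave:
  assumes "smooth_manifold M" "i \<in> cidx M" "snd z \<in> cimg M i"
  shows "param (plane_wave M \<H>) i z = (fst z, param M i (snd z))"
proof -
  let ?N = "plane_wave M \<H>"
  have inj: "inj_on (coord ?N i) (cdom ?N i)"
    using inj_on_coord[OF assms(1,2)] by (auto simp: inj_on_def)
  have "coord ?N i (fst z, param M i (snd z)) = z" "(fst z, param M i (snd z)) \<in> cdom ?N i"
    using coord_param[OF assms(3)] by auto
  then show ?thesis
    using inv_into_f_f[OF inj, of "(fst z, param M i (snd z))"] unfolding param_def by simp
qed

lemma transition_plane_wave:
  assumes "smooth_manifold M" "i \<in> cidx M" "snd z \<in> cimg M i"
  shows "local_rep (plane_wave M \<H>) (plane_wave M \<H>) id i j z = (fst z, local_rep M M id i j (snd z))"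
  by (simp add: local_rep_def param_plane_wave[OF assms])

lemma overlap_plane_wave:
  "coord (plane_wave M \<H>) i ` (cdom (plane_wave M \<H>) i \<inter> cdom (plane_wave M \<H>) j)
     = snd -` (coord M i ` (cdom M i \<inter> cdom M j))"
  by (force simp: image_iff)

lemma linear_snd: "linear (snd :: 'a::real_vector \<times> 'b::real_vector \<Rightarrow> 'b)"
  by (rule linearI) auto

lemma smooth_manifold_plane_wave:
  fixes M :: "('i, 'm, 'e::euclidean_space) rmfd"
  assumes "smooth_manifold M"
  shows "smooth_manifold (plane_wave M \<H>)"
proof -
  let ?N = "plane_wave M \<H>"
  have cdom: "cdom M i \<subseteq> topspace (mtop M)" "openin (mtop M) (cdom M i)" if "i \<in> cidx M" for i
    using cdom_subset_topspace[OF assms that] assms that unfolding smooth_manifold_def by auto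
  have H: "Hausdorff_space (mtop ?N)" and C: "second_countable (mtop ?N)"
    using assms second_countable_prod_topology[OF second_countable_euclidean]
    by (auto simp: smooth_manifold_def Hausdorff_space_prod_topology Hausdorff_space_euclidean)
  have U: "(\<Union>i\<in>cidx ?N. cdom ?N i) = topspace (mtop ?N)"
    using assms unfolding smooth_manifold_def by (auto simp: topspace_prod_topology)
  have o: "openin (mtop ?N) (cdom ?N i)" "open (cimg ?N i)" if "i \<in> cidx M" for i
    using that cdom open_cimg[OF assms] by (auto simp: openin_prod_Times_iff open_Times)
  have h: "homeomorphic_map (subtopology (mtop ?N) (cdom ?N i)) (top_of_set (cimg ?N i)) (coord ?N i)"
    if i: "i \<in> cidx M" for i
  proof -
    obtain g where "homeomorphic_maps (subtopology (mtop M) (cdom M i)) (top_of_set (cimg M i)) (coord M i) g"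
      using homeomorphic_coord[OF assms i] homeomorphic_map_maps by blast
    then have "homeomorphic_maps (prod_topology euclidean (subtopology (mtop M) (cdom M i)))
        (prod_topology euclidean (top_of_set (cimg M i)))
        (\<lambda>(x, y). (id x, coord M i y)) (\<lambda>(x, y). (id x, g y))"
      unfolding homeomorphic_maps_prod by (simp add: homeomorphic_maps_def[of euclidean])
    then have "homeomorphic_map (prod_topology euclidean (subtopology (mtop M) (cdom M i)))
        (prod_topology euclidean (top_of_set (cimg M i))) (\<lambda>(x, y). (id x, coord M i y))"
      using homeomorphic_map_maps by blast
    moreover have "subtopology (mtop ?N) (cdom ?N i) = prod_topology euclidean (subtopology (mtop M) (cdom M i))"
      by (simp add: subtopology_Times)
    moreover have "top_of_set (cimg ?N i) = prod_topology euclidean (top_of_set (cimg M i))"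
      using subtopology_Times[of euclidean euclidean UNIV "cimg M i"] by simp
    moreover have "coord ?N i = (\<lambda>(x, y). (id x, coord M i y))"
      by auto
    ultimately show ?thesis by simp
  qed
  have s: "smooth_on (coord ?N i ` (cdom ?N i \<inter> cdom ?N j)) (local_rep ?N ?N id i j)"
    if i: "i \<in> cidx M" and j: "j \<in> cidx M" for i j
  proof -
    let ?S = "coord M i ` (cdom M i \<inter> cdom M j)" and ?T = "snd -` (coord M i ` (cdom M i \<inter> cdom M j)) :: ((real \<times> real) \<times> 'e) set"
    have op: "open ?T" using open_overlap[OF assms i j] open_vimage_snd by blast
    have "C_on k ?T (local_rep ?N ?N id i j)" for k
    proof (rule C_on_cong[OF op])
      have "C_on k ?T (\<lambda>z. local_rep M M id i j (snd z))"
        by (rule C_on_comp_linear[OF open_overlap[OF assms i j] linear_snd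
              smooth_transition[OF assms i j, unfolded smooth_on_def, rule_format]])
      then have "C_on k ?T (\<lambda>z. (0 :: real \<times> real, local_rep M M id i j (snd z)))"
        by (rule C_on_linear_comp[OF op, of "\<lambda>y. (0, y)", rotated]) (auto intro: linearI)
      moreover have "C_on k ?T (\<lambda>z. (fst z, 0 :: 'e))"
        by (rule C_on_linear) (auto intro: linearI)
      ultimately show "C_on k ?T (\<lambda>z. (fst z, 0) + (0, local_rep M M id i j (snd z)))"
        by (intro C_on_add[OF op])
      show "(fst z, 0) + (0, local_rep M M id i j (snd z)) = local_rep ?N ?N id i j z"
        if "z \<in> ?T" for z
        using that transition_plane_wave[OF assms i, of z] by (auto simp: cimg_def)
    qed
    then show ?thesis unfolding overlap_plane_wave smooth_on_def by simp
  qed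
  show ?thesis
    unfolding smooth_manifold_def
  proof (intro conjI ballI)
    show "Hausdorff_space (mtop ?N)" "second_countable (mtop ?N)"
      "(\<Union>i\<in>cidx ?N. cdom ?N i) = topspace (mtop ?N)" by (fact H C U)+
    fix i assume "i \<in> cidx ?N"
    then have i: "i \<in> cidx M" by simp
    show "openin (mtop ?N) (cdom ?N i)" "open (cimg ?N i)"
      "homeomorphic_map (subtopology (mtop ?N) (cdom ?N i)) (top_of_set (cimg ?N i)) (coord ?N i)"
      by (fact o[OF i] h[OF i])+
    fix j assume "j \<in> cidx ?N"
    then have "j \<in> cidx M" by simp
    then show "smooth_on (coord ?N i ` (cdom ?N i \<inter> cdom ?N j)) (local_rep ?N ?N id i j)"
      by (rule s[OF i])
  qed
qed

text \<open>Nondegeneracy holds because the block of the metric in the coordinates \<open>(u, v)\<close> has determinant \<open>-1\<close>,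
  whatever \<open>\<H>\<close> is. The transition maps are \<open>id \<times> \<tau>\<close> with \<open>\<tau>\<close> a transition map of \<open>M\<close>, so compatibility
  reduces to that of the metric of \<open>M\<close>.\<close>

lemma metric_tensor_plane_wave:
  fixes M :: "('i, 'm, 'e::euclidean_space) rmfd"
  assumes sm: "smooth_manifold M" and mt: "metric_tensor M"
    and H: "smooth_fun (plane_wave M \<H>) (\<lambda>((u, v), x). \<H> u x)"
  shows "metric_tensor (plane_wave M \<H>)"
proof -
  let ?N = "plane_wave M \<H>"
  note smN = smooth_manifold_plane_wave[OF sm, of \<H>]
  have bil: "bilinear (gmet ?N i z)" if "i \<in> cidx M" "z \<in> cimg ?N i" for i z
  proof -
    note b = bilinear_gmet(1)[OF mt that(1), of "snd z"]
    show ?thesis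
      unfolding bilinear_def gmet_plane_wave using that b
      by (auto intro!: linearI simp: algebra_simps bilinear_ladd bilinear_radd bilinear_lmul bilinear_rmul)
  qed
  have sym: "gmet ?N i z V W = gmet ?N i z W V" if "i \<in> cidx M" "z \<in> cimg ?N i" for i z V W
    using that bilinear_gmet(2)[OF mt that(1), of "snd z" "snd V" "snd W"]
    by (auto simp: gmet_plane_wave algebra_simps)
  have nd: "V = 0" if "i \<in> cidx M" "z \<in> cimg ?N i" "\<And>W. gmet ?N i z V W = 0" for i z V
  proof -
    note b = bilinear_gmet[OF mt that(1), of "snd z"]
    have z: "snd z \<in> cimg M i" using that by auto
    \<comment> \<open>The tests with \<open>\<partial>\<^sub>v\<close> and then \<open>\<partial>\<^sub>u\<close> remove the two components in the plane.\<close>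
    have a: "fst (fst V) = 0"
      using that(3)[of "((0, 1), 0)"] bilinear_rzero[OF b(1)[OF z]] by (simp add: gmet_plane_wave)
    have b': "snd (fst V) = 0"
      using that(3)[of "((1, 0), 0)"] bilinear_rzero[OF b(1)[OF z]] a by (simp add: gmet_plane_wave)
    have "snd V = 0"
      by (rule b(3)[OF z]) (use that(3)[of "(0, _)"] a b' in \<open>simp add: gmet_plane_wave\<close>)
    with a b' show ?thesis by (simp add: prod_eq_iff)
  qed
  have smooth: "smooth_on (cimg ?N i) (\<lambda>z. gmet ?N i z V W)" if i: "i \<in> cidx M" for i V W
    unfolding smooth_on_def
  proof
    fix k
    have op: "open (cimg ?N i)" using open_cimg[OF smN] i by simp
    have "C_on k (cimg ?N i) ((\<lambda>((u, v), x). \<H> u x) \<circ> param ?N i)"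
      using H i unfolding smooth_fun_def smooth_on_def by simp
    then have "C_on k (cimg ?N i) (\<lambda>z. \<H> (fst (fst z)) (param M i (snd z)))"
      by (rule C_on_cong[OF op, rotated])
        (use param_plane_wave[OF sm i] in \<open>auto simp: case_prod_beta\<close>)
    then have 1: "C_on k (cimg ?N i) (\<lambda>z. \<H> (fst (fst z)) (param M i (snd z)) * fst (fst V) * fst (fst W))"
      by (rule C_on_linear_comp[OF op, of "\<lambda>h. h * fst (fst V) * fst (fst W)", rotated])
        (auto intro!: linearI simp: algebra_simps)
    have "C_on k (snd -` cimg M i) (\<lambda>z :: (real \<times> real) \<times> 'e. gmet M i (snd z) (snd V) (snd W))"
      by (rule C_on_comp_linear[OF open_cimg[OF sm i] linear_snd
            smooth_gmet[OF mt i, unfolded smooth_on_def, rule_format]])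
    moreover have "cimg ?N i = snd -` cimg M i" by auto
    ultimately have 2: "C_on k (cimg ?N i) (\<lambda>z. gmet M i (snd z) (snd V) (snd W))" by simp
    show "C_on k (cimg ?N i) (\<lambda>z. gmet ?N i z V W)"
      unfolding gmet_plane_wave by (intro C_on_add[OF op] 1 2 C_on_const)
  qed
  have trans: "gmet ?N i z V W = gmet ?N j (local_rep ?N ?N id i j z)
      (frechet_derivative (local_rep ?N ?N id i j) (at z) V)
      (frechet_derivative (local_rep ?N ?N id i j) (at z) W)"
    if i: "i \<in> cidx M" and j: "j \<in> cidx M" and z: "z \<in> snd -` (coord M i ` (cdom M i \<inter> cdom M j))"
    for i j z V W
  proof -
    let ?\<tau> = "local_rep M M id i j"
    let ?T = "snd -` (coord M i ` (cdom M i \<inter> cdom M j)) :: ((real \<times> real) \<times> 'e) set"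
    have op: "open ?T" using open_overlap[OF sm i j] open_vimage_snd by blast
    have y: "snd z \<in> coord M i ` (cdom M i \<inter> cdom M j)" "snd z \<in> cimg M i"
      using z by (auto simp: cimg_def)
    have "(?\<tau> has_derivative frechet_derivative ?\<tau> (at (snd z))) (at (snd z))"
      using smooth_onD(1)[OF smooth_transition[OF sm i j] y(1)]
      by (simp add: frechet_derivative_works[symmetric])
    then have "((\<lambda>z. (fst z, ?\<tau> (snd z))) has_derivative
        (\<lambda>h. (fst h, frechet_derivative ?\<tau> (at (snd z)) (snd h)))) (at z)"
      by (intro has_derivative_Pair has_derivative_fst has_derivative_ident
          has_derivative_compose[OF has_derivative_snd[OF has_derivative_ident]])
    then have "(local_rep ?N ?N id i j has_derivative
        (\<lambda>h. (fst h, frechet_derivative ?\<tau> (at (snd z)) (snd h)))) (at z)"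
      by (rule has_derivative_transform_within_open[OF _ op z])
        (use transition_plane_wave[OF sm i] in \<open>auto simp: cimg_def\<close>)
    from frechet_derivative_at[OF this, symmetric]
    have D: "frechet_derivative (local_rep ?N ?N id i j) (at z)
        = (\<lambda>h. (fst h, frechet_derivative ?\<tau> (at (snd z)) (snd h)))" .
    show ?thesis
      unfolding D transition_plane_wave[OF sm i y(2)] gmet_plane_wave
      using gmet_transition[OF mt i j y(1)] param_transition[OF sm i j y(1)] by simp
  qed
  show ?thesis
    unfolding metric_tensor_def Let_def overlap_plane_wave
  proof (intro conjI ballI allI impI)
    show "gmet ?N i z V W = gmet ?N j (local_rep ?N ?N id i j z)
        (frechet_derivative (local_rep ?N ?N id i j) (at z) V)
        (frechet_derivative (local_rep ?N ?N id i j) (at z) W)"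
      if "i \<in> cidx ?N" "j \<in> cidx ?N" "z \<in> snd -` (coord M i ` (cdom M i \<inter> cdom M j))" for i j z V W
      using trans that by simp
    show "V = 0" if "i \<in> cidx ?N" "z \<in> cimg ?N i" "\<forall>W. gmet ?N i z V W = 0" for i z V
      using nd[of i z V] that by simp
    show "bilinear (gmet ?N i z)" "gmet ?N i z V W = gmet ?N i z W V"
      if "i \<in> cidx ?N" "z \<in> cimg ?N i" for i z V W
      using bil[of i z] sym[of i z V W] that by simp_all
    show "smooth_on (cimg ?N i) (\<lambda>z. gmet ?N i z V W)" if "i \<in> cidx ?N" for i V W
      using smooth[of i V W] that by simp
  qed
qed


section \<open>Differentiating metric expressions\<close>

lemma bilinear_expand:
  fixes B :: "'f::euclidean_space \<Rightarrow> 'f \<Rightarrow> real"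
  assumes "bilinear B"
  shows "B v w = (\<Sum>i\<in>Basis. \<Sum>j\<in>Basis. (v \<bullet> i) * (w \<bullet> j) * B i j)"
proof -
  have "B v w = B (\<Sum>i\<in>Basis. (v \<bullet> i) *\<^sub>R i) (\<Sum>j\<in>Basis. (w \<bullet> j) *\<^sub>R j)"
    by (simp add: euclidean_representation)
  also have "\<dots> = (\<Sum>(i, j)\<in>Basis \<times> Basis. B ((v \<bullet> i) *\<^sub>R i) ((w \<bullet> j) *\<^sub>R j))"
    by (rule bilinear_sum[OF assms])
  also have "\<dots> = (\<Sum>i\<in>Basis. \<Sum>j\<in>Basis. B ((v \<bullet> i) *\<^sub>R i) ((w \<bullet> j) *\<^sub>R j))"
    by (rule sum.cartesian_product[symmetric])
  finally show ?thesis
    by (simp add: bilinear_lmul[OF assms] bilinear_rmul[OF assms] mult_ac)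
qed

text \<open>The product rule for the value of a metric on two vector fields along a map \<open>p\<close>. After expansion
  in components, both sides become finite sums of products of real functions.\<close>

lemma has_derivative_bilinear_field:
  fixes B :: "'a::real_normed_vector \<Rightarrow> 'f::euclidean_space \<Rightarrow> 'f \<Rightarrow> real"
    and p :: "'d::real_normed_vector \<Rightarrow> 'a"
  assumes U: "open U" "q \<in> U" and bil: "\<And>z. z \<in> U \<Longrightarrow> bilinear (B z)"
    and D: "\<And>v w. ((\<lambda>z. B z v w) has_derivative D v w) (at q)"
    and q: "p y = q" and p: "(p has_derivative p') (at y)"
    and a: "(a has_derivative a') (at y)" and b: "(b has_derivative b') (at y)"
  shows "((\<lambda>x. B (p x) (a x) (b x)) has_derivative
     (\<lambda>h. D (a y) (b y) (p' h) + B q (a' h) (b y) + B q (a y) (b' h))) (at y)"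
proof -
  have D_expand: "D v w h = (\<Sum>i\<in>Basis. \<Sum>j\<in>Basis. (v \<bullet> i) * (w \<bullet> j) * D i j h)" for v w h
  proof -
    have "((\<lambda>z. \<Sum>i\<in>Basis. \<Sum>j\<in>Basis. (v \<bullet> i) * (w \<bullet> j) * B z i j) has_derivative
       (\<lambda>h. \<Sum>i\<in>Basis. \<Sum>j\<in>Basis. (v \<bullet> i) * (w \<bullet> j) * D i j h)) (at q)"
      by (intro has_derivative_sum has_derivative_mult_right D)
    then have "((\<lambda>z. B z v w) has_derivative
       (\<lambda>h. \<Sum>i\<in>Basis. \<Sum>j\<in>Basis. (v \<bullet> i) * (w \<bullet> j) * D i j h)) (at q)"
      by (rule has_derivative_transform_within_open[OF _ U])
        (rule bilinear_expand[OF bil, symmetric])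
    from has_derivative_unique[OF D this] show ?thesis by (rule fun_cong)
  qed
  have Dp: "((\<lambda>x. B (p x) i j) has_derivative (\<lambda>h. D i j (p' h))) (at y)" for i j
    using has_derivative_compose[OF p D[folded q]] unfolding q .
  have summand: "((\<lambda>x. (a x \<bullet> i) * (b x \<bullet> j) * B (p x) i j) has_derivative
      (\<lambda>h. (a y \<bullet> i) * (b y \<bullet> j) * D i j (p' h) + (a' h \<bullet> i) * (b y \<bullet> j) * B q i j
         + (a y \<bullet> i) * (b' h \<bullet> j) * B q i j)) (at y)" for i j
    by (rule has_derivative_eq_rhs[OF has_derivative_mult[OF has_derivative_mult[OF
            has_derivative_inner_left[OF a] has_derivative_inner_left[OF b]] Dp]])
      (simp add: algebra_simps q)
  have "((\<lambda>x. \<Sum>i\<in>Basis. \<Sum>j\<in>Basis. (a x \<bullet> i) * (b x \<bullet> j) * B (p x) i j) has_derivative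
      (\<lambda>h. \<Sum>i\<in>Basis. \<Sum>j\<in>Basis. (a y \<bullet> i) * (b y \<bullet> j) * D i j (p' h)
         + (a' h \<bullet> i) * (b y \<bullet> j) * B q i j + (a y \<bullet> i) * (b' h \<bullet> j) * B q i j)) (at y)"
    by (intro has_derivative_sum summand)
  also have "(\<lambda>h. \<Sum>i\<in>Basis. \<Sum>j\<in>Basis. (a y \<bullet> i) * (b y \<bullet> j) * D i j (p' h)
         + (a' h \<bullet> i) * (b y \<bullet> j) * B q i j + (a y \<bullet> i) * (b' h \<bullet> j) * B q i j)
      = (\<lambda>h. D (a y) (b y) (p' h) + B q (a' h) (b y) + B q (a y) (b' h))"
    by (simp only: sum.distrib D_expand[of "a y" "b y"] bilinear_expand[OF bil[OF U(2)], of _ "b y"]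
        bilinear_expand[OF bil[OF U(2)], of "a y"])
  finally have *: "((\<lambda>x. \<Sum>i\<in>Basis. \<Sum>j\<in>Basis. (a x \<bullet> i) * (b x \<bullet> j) * B (p x) i j) has_derivative
      (\<lambda>h. D (a y) (b y) (p' h) + B q (a' h) (b y) + B q (a y) (b' h))) (at y)" .
  have "(p \<longlongrightarrow> q) (at y)"
    using has_derivative_continuous[OF p] q by (simp add: isCont_def)
  from topological_tendstoD[OF this U] have ev: "\<forall>\<^sub>F x in at y. p x \<in> U" .
  show ?thesis
    by (rule has_derivative_transform_eventually[OF *])
      (use ev U q bilinear_expand[OF bil] in \<open>auto elim!: eventually_mono\<close>)
qed

text \<open>At a zero of \<open>h\<close> the product rule needs only continuity of the other factor. This is what allows
  the differentiability of a function to be derived from an equation in which the function itself occurs.\<close>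

lemma has_derivative_scaleR_vanishing:
  fixes f :: "'a::real_normed_vector \<Rightarrow> real" and h :: "'a \<Rightarrow> 'b::real_normed_vector"
  assumes f: "isCont f y" and h: "(h has_derivative h') (at y)" and 0: "h y = 0"
  shows "((\<lambda>x. f x *\<^sub>R h x) has_derivative (\<lambda>k. f y *\<^sub>R h' k)) (at y)"
proof -
  \<comment> \<open>With \<open>r\<close> the remainder of \<open>h\<close>, the remainder of the product is \<open>f x r(x) + (f x - f y) h' (x - y)\<close>.\<close>
  have bl: "bounded_linear h'" using h by (rule has_derivative_bounded_linear)
  then obtain K where K: "K > 0" "\<And>k. norm (h' k) \<le> norm k * K"
    using bounded_linear.pos_bounded by blast
  have fl: "(f \<longlongrightarrow> f y) (at y)" using f by (simp add: isCont_def)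
  have q: "((\<lambda>x. (h x - h' (x - y)) /\<^sub>R norm (x - y)) \<longlongrightarrow> 0) (at y)"
    using h 0 by (simp add: has_derivative_at_within)
  have 1: "((\<lambda>x. f x *\<^sub>R ((h x - h' (x - y)) /\<^sub>R norm (x - y))) \<longlongrightarrow> 0) (at y)"
    using tendsto_scaleR[OF fl q] by simp
  have "((\<lambda>x. \<bar>f x - f y\<bar> * K) \<longlongrightarrow> 0) (at y)"
    using tendsto_mult_left[OF tendsto_rabs[OF Lim_null[THEN iffD1, OF fl]], of K]
    by (simp add: mult.commute)
  then have 2: "((\<lambda>x. (f x - f y) *\<^sub>R (h' (x - y) /\<^sub>R norm (x - y))) \<longlongrightarrow> 0) (at y)"
  proof (rule Lim_null_comparison[rotated], intro always_eventually allI)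
    fix x
    have "norm (h' (x - y)) / norm (x - y) \<le> K"
      using K(2)[of "x - y"] K(1) by (cases "x = y") (auto simp: field_simps)
    then have "\<bar>f x - f y\<bar> * (norm (h' (x - y)) / norm (x - y)) \<le> \<bar>f x - f y\<bar> * K"
      by (rule mult_left_mono) simp
    then show "norm ((f x - f y) *\<^sub>R (h' (x - y) /\<^sub>R norm (x - y))) \<le> \<bar>f x - f y\<bar> * K"
      by (simp add: divide_inverse abs_mult mult_ac)
  qed
  have "f x *\<^sub>R ((h x - h' (x - y)) /\<^sub>R norm (x - y)) + (f x - f y) *\<^sub>R (h' (x - y) /\<^sub>R norm (x - y))
      = (f x *\<^sub>R h x - f y *\<^sub>R h' (x - y)) /\<^sub>R norm (x - y)" for x
    by (simp add: algebra_simps)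
  with tendsto_add[OF 1 2]
  have "((\<lambda>x. (f x *\<^sub>R h x - f y *\<^sub>R h' (x - y)) /\<^sub>R norm (x - y)) \<longlongrightarrow> 0) (at y)" by simp
  then show ?thesis
    unfolding has_derivative_at_within using 0
      bounded_linear_compose[OF bounded_linear_scaleR_right bl] by simp
qed

text \<open>The solution of a linear system depends differentiably on the system. If \<open>L\<close> is the inverse of
  \<open>A y\<close>, the solution satisfies \<open>X x = L (a x - (A x - A y) (X x))\<close>. Since \<open>A y\<close> is bounded below,
  \<open>X\<close> is bounded near \<open>y\<close>; the equation then shows that \<open>X\<close> is continuous at \<open>y\<close>, and, because
  \<open>A x - A y\<close> vanishes at \<open>y\<close>, even differentiable there.\<close>

lemma differentiable_linear_solution:
  fixes A :: "'a::real_normed_vector \<Rightarrow> 'e::euclidean_space \<Rightarrow> 'e"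
  assumes U: "open U" "y \<in> U" and lin: "\<And>x. x \<in> U \<Longrightarrow> linear (A x)"
    and inj: "inj (A y)" and dA: "\<And>v. (\<lambda>x. A x v) differentiable at y"
    and da: "a differentiable at y" and X: "\<And>x. x \<in> U \<Longrightarrow> A x (X x) = a x"
  shows "X differentiable at y"
proof -
  define h where "h j x = A x j - A y j" for j x
  have linA: "linear (A y)" using lin U by simp
  obtain L where L: "linear L" "\<And>v. L (A y v) = v"
    using linear_injective_left_inverse[OF linA inj] by (auto simp: o_def fun_eq_iff)
  obtain \<beta> where \<beta>: "\<beta> > 0" "\<And>v. \<beta> * norm v \<le> norm (A y v)"
    using linear_inj_bounded_below_pos[OF linA inj] by blast
  have A_expand: "A x v - A y v = (\<Sum>j\<in>Basis. (v \<bullet> j) *\<^sub>R h j x)" if "x \<in> U" for x v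
  proof -
    have "A x v = (\<Sum>j\<in>Basis. (v \<bullet> j) *\<^sub>R A x j)" if "x \<in> U" for x
    proof -
      have "A x v = A x (\<Sum>j\<in>Basis. (v \<bullet> j) *\<^sub>R j)" by (simp add: euclidean_representation)
      also have "\<dots> = (\<Sum>j\<in>Basis. (v \<bullet> j) *\<^sub>R A x j)"
        by (simp only: linear_sum[OF lin[OF that]] linear_cmul[OF lin[OF that]])
      finally show ?thesis .
    qed
    from this[OF that] this[OF U(2)] show ?thesis
      by (simp add: h_def scaleR_diff_right sum_subtractf)
  qed
  have dh: "(h j has_derivative frechet_derivative (\<lambda>x. A x j) (at y)) (at y)" for j
    unfolding h_def
    by (rule has_derivative_eq_rhs[OF has_derivative_diff[OF
            dA[unfolded frechet_derivative_works] has_derivative_const]]) simp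
  have h0: "h j y = 0" for j by (simp add: h_def)
  have h_lim: "(h j \<longlongrightarrow> 0) (at y)" for j
    using has_derivative_continuous[OF dh, of j] h0 by (simp add: isCont_def)
  have a_lim: "(a \<longlongrightarrow> a y) (at y)"
    using differentiable_imp_continuous_within[OF da] by (simp add: isCont_def)
  have X_eq: "X x = L (a x - (\<Sum>j\<in>Basis. (X x \<bullet> j) *\<^sub>R h j x))" if "x \<in> U" for x
    using A_expand[OF that, of "X x"] X[OF that] L(2)[of "X x"] by (simp add: algebra_simps)
  have in_U: "\<forall>\<^sub>F x in at y. x \<in> U"
    using U by (simp add: eventually_at_in_open')
  \<comment> \<open>The operator norm of \<open>A x - A y\<close> is at most the sum of the norms of the \<open>h j x\<close>.\<close>
  have "((\<lambda>x. \<Sum>j\<in>Basis. norm (h j x)) \<longlongrightarrow> (\<Sum>j\<in>(Basis::'e set). 0)) (at y)"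
    by (intro tendsto_sum tendsto_norm_zero h_lim)
  then have "\<forall>\<^sub>F x in at y. (\<Sum>j\<in>Basis. norm (h j x)) < \<beta> / 2"
    by (rule order_tendstoD) (use \<beta> in simp)
  moreover have "\<forall>\<^sub>F x in at y. norm (a x) < norm (a y) + 1"
    by (rule order_tendstoD[OF tendsto_norm[OF a_lim]]) simp
  ultimately have bdd: "\<forall>\<^sub>F x in at y. norm (X x) \<le> 2 * (norm (a y) + 1) / \<beta>"
    using in_U
  proof eventually_elim
    case (elim x)
    have "norm (A x (X x) - A y (X x)) \<le> (\<Sum>j\<in>Basis. norm (X x) * norm (h j x))"
      unfolding A_expand[OF elim(3)]
      by (rule sum_norm_le) (auto intro!: mult_right_mono Basis_le_norm)
    also have "\<dots> = norm (X x) * (\<Sum>j\<in>Basis. norm (h j x))" by (simp add: sum_distrib_left)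
    also have "\<dots> \<le> norm (X x) * (\<beta> / 2)" using elim(1) by (intro mult_left_mono) auto
    finally have 1: "norm (a x - A y (X x)) \<le> norm (X x) * (\<beta> / 2)"
      using X[OF elim(3)] by simp
    have "norm (A y (X x)) \<le> norm (a x) + norm (a x - A y (X x))"
      using norm_triangle_sub[of "A y (X x)" "a x"] by (simp add: norm_minus_commute)
    then have "\<beta> * norm (X x) \<le> (norm (a y) + 1) + norm (X x) * (\<beta> / 2)"
      using \<beta>(2)[of "X x"] 1 elim(2) by linarith
    then show ?case using \<beta>(1) by (simp add: field_simps)
  qed
  have X_lim: "isCont X y"
  proof -
    have "((\<lambda>x. (X x \<bullet> j) *\<^sub>R h j x) \<longlongrightarrow> 0) (at y)" if j: "j \<in> Basis" for j
    proof (rule Lim_null_comparison)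
      show "\<forall>\<^sub>F x in at y. norm ((X x \<bullet> j) *\<^sub>R h j x) \<le> (2 * (norm (a y) + 1) / \<beta>) * norm (h j x)"
        using bdd
      proof eventually_elim
        case (elim x)
        then have "\<bar>X x \<bullet> j\<bar> \<le> 2 * (norm (a y) + 1) / \<beta>"
          using Basis_le_norm[OF j, of "X x"] by linarith
        then show ?case
          unfolding norm_scaleR by (rule mult_right_mono) simp
      qed
      show "((\<lambda>x. (2 * (norm (a y) + 1) / \<beta>) * norm (h j x)) \<longlongrightarrow> 0) (at y)"
        using tendsto_mult_left[OF tendsto_norm_zero[OF h_lim[of j]],
            of "2 * (norm (a y) + 1) / \<beta>"] by simp
    qed
    then have "((\<lambda>x. a x - (\<Sum>j\<in>Basis. (X x \<bullet> j) *\<^sub>R h j x)) \<longlongrightarrow> a y - (\<Sum>j\<in>(Basis::'e set). 0)) (at y)"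
      by (intro tendsto_diff a_lim tendsto_sum)
    from bounded_linear.tendsto[OF L(1)[unfolded linear_conv_bounded_linear] this]
    have "((\<lambda>x. L (a x - (\<Sum>j\<in>Basis. (X x \<bullet> j) *\<^sub>R h j x))) \<longlongrightarrow> X y) (at y)"
      using L(2)[of "X y"] X[OF U(2)] by simp
    then show ?thesis
      unfolding isCont_def
      by (rule Lim_transform_eventually) (use in_U X_eq in \<open>auto elim!: eventually_mono\<close>)
  qed
  have "((\<lambda>x. L (a x - (\<Sum>j\<in>Basis. (X x \<bullet> j) *\<^sub>R h j x))) has_derivative
      (\<lambda>k. L (frechet_derivative a (at y) k
         - (\<Sum>j\<in>Basis. (X y \<bullet> j) *\<^sub>R frechet_derivative (\<lambda>x. A x j) (at y) k)))) (at y)"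
    by (intro has_derivative_linear_comp[OF L(1)] has_derivative_diff has_derivative_sum
        has_derivative_scaleR_vanishing dh h0 da[unfolded frechet_derivative_works]
        isCont_inner[OF X_lim continuous_const])
  then have "(X has_derivative
      (\<lambda>k. L (frechet_derivative a (at y) k
         - (\<Sum>j\<in>Basis. (X y \<bullet> j) *\<^sub>R frechet_derivative (\<lambda>x. A x j) (at y) k)))) (at y)"
    by (rule has_derivative_transform_within_open[OF _ U]) (use X_eq in simp)
  then show ?thesis by (rule differentiableI)
qed

text \<open>The field of vectors dual to a field of covectors is differentiable, which is needed before a gradient
  can be differentiated covariantly.\<close>

lemma differentiable_dual_vector:
  fixes g :: "'a::real_normed_vector \<Rightarrow> 'e::euclidean_space \<Rightarrow> 'e \<Rightarrow> real"
  assumes U: "open U" "y \<in> U" and bil: "\<And>x. x \<in> U \<Longrightarrow> bilinear (g x)"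
    and nd: "\<And>v. (\<And>w. g y v w = 0) \<Longrightarrow> v = 0"
    and dg: "\<And>v w. (\<lambda>x. g x v w) differentiable at y"
    and d\<alpha>: "\<And>w. (\<lambda>x. \<alpha> x w) differentiable at y"
    and X: "\<And>x w. x \<in> U \<Longrightarrow> g x (X x) w = \<alpha> x w"
  shows "X differentiable at y"
proof -
  let ?A = "\<lambda>x v. \<Sum>b\<in>Basis. g x v b *\<^sub>R b"
  have scale: "(\<lambda>x. r x *\<^sub>R b) differentiable at y" if "r differentiable at y" for r and b :: 'e
    using has_derivative_scaleR[OF that[unfolded frechet_derivative_works] has_derivative_const]
    by (rule differentiableI)
  have A_inner: "?A x v \<bullet> b = g x v b" if "b \<in> Basis" for x v b
    using that by simp
  have lin: "linear (?A x)" if "x \<in> U" for x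
    using bil[OF that]
    by (intro linearI)
      (simp_all add: bilinear_ladd bilinear_lmul scaleR_left_distrib sum.distrib scaleR_sum_right)
  have "inj (?A y)"
  proof (subst linear_injective_0[OF lin[OF U(2)]], intro allI impI)
    fix v assume "?A y v = 0"
    then have "g y v b = 0" if "b \<in> Basis" for b
      using A_inner[OF that, of y v] by simp
    then have "g y v w = 0" for w
      using bilinear_expand[OF bil[OF U(2)], of v w] linear_0[OF lin[OF U(2)]]
      by (subst euclidean_representation[of w, symmetric])
        (simp add: linear_sum[of "g y v"] linear_cmul[of "g y v"] bil[OF U(2), unfolded bilinear_def])
    then show "v = 0" by (rule nd)
  qed
  moreover have "(\<lambda>x. ?A x v) differentiable at y" for v
    by (intro differentiable_sum finite_Basis ballI scale dg)
  moreover have "(\<lambda>x. \<Sum>b\<in>Basis. \<alpha> x b *\<^sub>R b) differentiable at y"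
    by (intro differentiable_sum finite_Basis ballI scale d\<alpha>)
  ultimately show ?thesis
    using differentiable_linear_solution[OF U, of ?A "\<lambda>x. \<Sum>b\<in>Basis. \<alpha> x b *\<^sub>R b" X] lin X
    by simp
qed


section \<open>The Laplacian as the trace of the Hessian\<close>

lemma gmet_derivative:
  assumes "smooth_manifold M" "metric_tensor M" "i \<in> cidx M" "y \<in> cimg M i"
  shows "((\<lambda>x. gmet M i x v w) has_derivative frechet_derivative (\<lambda>x. gmet M i x v w) (at y)) (at y)"
  using smooth_onD(1)[OF smooth_gmet[OF assms(2,3)] assms(4)]
  by (simp add: frechet_derivative_works[symmetric])

text \<open>The components in chart \<open>i\<close> of the covariant Hessian \<open>\<nabla>df\<close>.\<close>

definition hessian ::
  "('i, 'p, 'e::euclidean_space) rmfd \<Rightarrow> 'i \<Rightarrow> ('p \<Rightarrow> real) \<Rightarrow> 'e \<Rightarrow> 'e \<Rightarrow> 'e \<Rightarrow> real" where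
  "hessian M i f y v w =
     frechet_derivative (\<lambda>x. frechet_derivative (f \<circ> param M i) (at x) w) (at y) v
     - frechet_derivative (f \<circ> param M i) (at y) (christoffel M i y v w)"

lemma gmet_gradient:
  assumes "metric_tensor M" "i \<in> cidx M" "y \<in> cimg M i" "(f \<circ> param M i) differentiable at y"
  shows "gmet M i y (gradient M i f y) w = frechet_derivative (f \<circ> param M i) (at y) w"
  unfolding gradient_def
  by (rule sharp_eqI[OF bilinear_gmet(1)[OF assms(1-3)]])
    (use bilinear_gmet(3)[OF assms(1-3)] linear_frechet_derivative[OF assms(4)] in auto)

text \<open>Differentiate \<open>\<langle>\<nabla>f, W\<rangle> = df(W)\<close> for a field \<open>W\<close> with constant components, and use that the connection
  is compatible with the metric.\<close>

lemma gmet_cov_deriv_gradient: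
  assumes M: "smooth_manifold M" "metric_tensor M" and i: "i \<in> cidx M" and y: "y \<in> cimg M i"
    and f: "smooth_on (cimg M i) (f \<circ> param M i)"
  shows "gmet M i y (cov_deriv M i (gradient M i f) y v) w = hessian M i f y v w"
proof -
  let ?g = "gmet M i" and ?X = "gradient M i f" and ?Df = "\<lambda>x. frechet_derivative (f \<circ> param M i) (at x)"
  note op = open_cimg[OF M(1) i]
  note bil = bilinear_gmet[OF M(2) i]
  have X: "?g x (?X x) w = ?Df x w" if "x \<in> cimg M i" for x w
    by (rule gmet_gradient[OF M(2) i that smooth_onD(1)[OF f that]])
  have dX: "?X differentiable at y"
    by (rule differentiable_dual_vector[OF op y, of ?g ?Df])
      (use bil y X smooth_onD(1)[OF smooth_gmet[OF M(2) i] y] smooth_onD(2)[OF f y] in auto)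
  let ?DX = "frechet_derivative ?X (at y)"
  have "((\<lambda>x. ?g x (?X x) w) has_derivative
      (\<lambda>h. frechet_derivative (\<lambda>x. ?g x (?X y) w) (at y) h + ?g y (?DX h) w + ?g y (?X y) 0)) (at y)"
    using has_derivative_bilinear_field[where B = ?g and U = "cimg M i" and q = y
        and p = "\<lambda>x. x" and y = y and p' = "\<lambda>h. h"
        and D = "\<lambda>v w. frechet_derivative (\<lambda>x. ?g x v w) (at y)" and a = ?X and a' = ?DX
        and b = "\<lambda>_. w" and b' = "\<lambda>_. 0"]
      op y bil(1) gmet_derivative[OF M i y] dX[unfolded frechet_derivative_works] by simp
  then have "((\<lambda>x. ?Df x w) has_derivative
      (\<lambda>h. frechet_derivative (\<lambda>x. ?g x (?X y) w) (at y) h + ?g y (?DX h) w + ?g y (?X y) 0)) (at y)"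
    by (rule has_derivative_transform_within_open[OF _ op y]) (rule X)
  from fun_cong[OF frechet_derivative_at[OF this], of v]
  have "frechet_derivative (\<lambda>x. ?Df x w) (at y) v =
      frechet_derivative (\<lambda>x. ?g x (?X y) w) (at y) v + ?g y (?DX v) w"
    by (simp add: bilinear_rzero[OF bil(1)[OF y]])
  also have "\<dots> = ?g y (christoffel M i y v (?X y)) w + ?Df y (christoffel M i y v w) + ?g y (?DX v) w"
    unfolding christoffel_metric[OF M i y] X[OF y] ..
  finally show ?thesis
    unfolding hessian_def cov_deriv_def bilinear_ladd[OF bil(1)[OF y]] by simp
qed

text \<open>The trace of the endomorphism \<open>v \<mapsto> \<nabla>\<^sub>v \<nabla>f\<close> is the metric trace of the bilinear form dual to it.\<close>

lemma divergence_gradient: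
  assumes M: "smooth_manifold M" "metric_tensor M" and i: "i \<in> cidx M" and y: "y \<in> cimg M i"
    and f: "smooth_on (cimg M i) (f \<circ> param M i)"
  shows "divergence M i (gradient M i f) y = metric_trace (gmet M i y) (hessian M i f y)"
  unfolding divergence_def metric_trace_def
proof (rule sum.cong[OF refl])
  fix b :: 'c
  let ?C = "cov_deriv M i (gradient M i f) y b"
  note bil = bilinear_gmet[OF M(2) i y]
  have "?C \<bullet> b = gmet M i y (sharp (gmet M i y) (\<lambda>w. w \<bullet> b)) ?C"
    by (rule sharp_eqI[OF bil(1), symmetric])
      (use bil(3) in \<open>auto intro: bounded_linear.linear bounded_linear_inner_left\<close>)
  also have "\<dots> = gmet M i y ?C (sharp (gmet M i y) (\<lambda>w. w \<bullet> b))" by (rule bil(2))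
  also have "\<dots> = hessian M i f y b (sharp (gmet M i y) (\<lambda>w. w \<bullet> b))"
    by (rule gmet_cov_deriv_gradient[OF M i y f])
  finally show "?C \<bullet> b = \<dots>" .
qed


section \<open>Linear algebra of a spacelike hyperplane\<close>

lemma hyperplane_complement:
  fixes D :: "'d::euclidean_space \<Rightarrow> 'f::euclidean_space"
  assumes D: "linear D" "inj D" and dim: "DIM('f) = DIM('d) + 1" and n: "n \<notin> range D"
  shows "\<exists>a w. x = a *\<^sub>R n + D w"
proof -
  have sub: "subspace (range D)" using D(1) linear_subspace_image subspace_UNIV by blast
  have "dim (range D) = DIM('d)" using dim_image_eq[OF D(1), of UNIV] D(2) by simp
  then have "dim (insert n (range D)) = DIM('f)"
    using n dim by (simp add: dim_insert span_eq_iff[THEN iffD2, OF sub])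
  then have "x \<in> span (insert n (range D))" using dim_eq_full by auto
  then obtain a where "x - a *\<^sub>R n \<in> span (range D)" by (auto simp: span_insert)
  then obtain w where "x - a *\<^sub>R n = D w" by (auto simp: span_eq_iff[THEN iffD2, OF sub])
  then show ?thesis by (intro exI[of _ a] exI[of _ w]) (simp add: algebra_simps)
qed

text \<open>A lightlike vector \<open>T\<close> lies outside a spacelike hyperplane, so \<open>T\<close> and the hyperplane span the whole
  space. If \<open>T\<close> were orthogonal to the hyperplane, it would be orthogonal to everything.\<close>

lemma lightlike_not_normal:
  fixes D :: "'d::euclidean_space \<Rightarrow> 'f::euclidean_space" and g :: "'f \<Rightarrow> 'f \<Rightarrow> real"
  assumes D: "linear D" "inj D" and dim: "DIM('f) = DIM('d) + 1"
    and g: "bilinear g" "\<And>x. (\<And>z. g x z = 0) \<Longrightarrow> x = 0"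
    and pos: "\<And>w. w \<noteq> 0 \<Longrightarrow> 0 < g (D w) (D w)"
    and T: "g T T = 0" "T \<noteq> 0"
  shows "\<exists>w. g T (D w) \<noteq> 0"
proof (rule ccontr)
  assume "\<not> ?thesis"
  then have 0: "g T (D w) = 0" for w by blast
  have "T \<notin> range D"
  proof
    assume "T \<in> range D"
    then obtain w where w: "T = D w" by blast
    then have "w = 0" using pos[of w] T(1) by (cases "w = 0") auto
    then show False using T(2) w linear_0[OF D(1)] by simp
  qed
  have "g T z = 0" for z
  proof -
    obtain a w where "z = a *\<^sub>R T + D w" using hyperplane_complement[OF D dim \<open>T \<notin> range D\<close>] by blast
    then show ?thesis by (simp add: bilinear_radd[OF g(1)] bilinear_rmul[OF g(1)] T(1) 0)
  qed
  then show False using g(2) T(2) by blast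
qed

text \<open>The normal is obtained by subtracting from the lightlike vector \<open>T\<close> its tangential part \<open>D s\<close>:
  \<open>n = T - D s\<close> satisfies \<open>\<langle>n, n\<rangle> = \<langle>n, T\<rangle> = -\<langle>D s, D s\<rangle>\<close>, and this is negative since \<open>T\<close> is not
  normal. The last clause says that the
  normal space is a line, from which uniqueness of the unit normal follows.\<close>

lemma unit_normal_exists:
  fixes D :: "'d::euclidean_space \<Rightarrow> 'f::euclidean_space" and g :: "'f \<Rightarrow> 'f \<Rightarrow> real"
  assumes D: "linear D" "inj D" and dim: "DIM('f) = DIM('d) + 1"
    and g: "bilinear g" "\<And>x. (\<And>z. g x z = 0) \<Longrightarrow> x = 0" "\<And>x z. g x z = g z x"
    and pos: "\<And>w. w \<noteq> 0 \<Longrightarrow> 0 < g (D w) (D w)"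
    and T: "g T T = 0" "T \<noteq> 0"
  shows "\<exists>\<nu>. (\<forall>w. g \<nu> (D w) = 0) \<and> g \<nu> \<nu> = -1 \<and> g \<nu> T < 0 \<and>
             (\<forall>x. (\<forall>w. g x (D w) = 0) \<longrightarrow> (\<exists>a. x = a *\<^sub>R \<nu>))"
proof -
  note bil = bilinear_ladd[OF g(1)] bilinear_lmul[OF g(1)] bilinear_radd[OF g(1)]
    bilinear_rmul[OF g(1)] bilinear_lsub[OF g(1)] bilinear_rsub[OF g(1)]
  let ?G = "\<lambda>v w. g (D v) (D w)"
  have G: "bilinear ?G"
    unfolding bilinear_def
    by (intro conjI allI linearI) (simp_all add: linear_add[OF D(1)] linear_cmul[OF D(1)] bil)
  define s where "s = sharp ?G (\<lambda>w. g T (D w))"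
  have s: "g (D s) (D w) = g T (D w)" for w
    unfolding s_def
  proof (rule sharp_eqI[OF G])
    show "v = 0" if "\<And>w. g (D v) (D w) = 0" for v
      using pos[of v] that[of v] by (cases "v = 0") auto
    show "linear (\<lambda>w. g T (D w))"
      by (intro linearI) (simp_all add: linear_add[OF D(1)] linear_cmul[OF D(1)] bil)
  qed
  define n where "n = T - D s"
  have n_D: "g n (D w) = 0" for w using s by (simp add: n_def bil)
  have n_T: "g n T = - g (D s) (D s)" using s[of s] g(3)[of "D s" T] T(1) by (simp add: n_def bil)
  have n_n: "g n n = - g (D s) (D s)"
    using n_T n_D[of s] by (subst (2) n_def) (simp add: bil)
  have "s \<noteq> 0"
    using lightlike_not_normal[OF D dim g(1,2) pos T] s by (auto simp: linear_0[OF D(1)] bilinear_lzero[OF g(1)])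
  then have P: "0 < g (D s) (D s)" (is "0 < ?P") by (rule pos)
  define \<nu> where "\<nu> = (1 / sqrt ?P) *\<^sub>R n"
  have r: "sqrt ?P > 0" "sqrt ?P * sqrt ?P = ?P" using P by auto
  have n_out: "n \<notin> range D" using n_D n_n P by auto
  have "\<exists>a. x = a *\<^sub>R \<nu>" if x: "\<forall>w. g x (D w) = 0" for x
  proof -
    obtain a w where xw: "x = a *\<^sub>R n + D w" using hyperplane_complement[OF D dim n_out] by blast
    then have "g (D w) (D w) = 0" using x[rule_format, of w] n_D[of w] by (simp add: bil)
    then have "w = 0" using pos[of w] by (cases "w = 0") auto
    then have "x = (a * sqrt ?P) *\<^sub>R \<nu>" using r(1) xw linear_0[OF D(1)] by (simp add: \<nu>_def)
    then show ?thesis by blast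
  qed
  moreover have "g \<nu> \<nu> = -1" using r P by (simp add: \<nu>_def bil n_n field_simps)
  moreover have "g \<nu> T < 0" using r P by (simp add: \<nu>_def bil n_T)
  moreover have "g \<nu> (D w) = 0" for w by (simp add: \<nu>_def bil n_D)
  ultimately show ?thesis by blast
qed


section \<open>Spacelike hypersurfaces\<close>

lemma induced_simps [simp]:
  "mtop (induced S N \<psi>) = mtop S" "cidx (induced S N \<psi>) = cidx S"
  "cdom (induced S N \<psi>) = cdom S" "coord (induced S N \<psi>) = coord S"
  "cimg (induced S N \<psi>) = cimg S" "param (induced S N \<psi>) = param S"
  "chart_at (induced S N \<psi>) = chart_at S"
  by (simp_all add: induced_def cimg_def param_def chart_at_def fun_eq_iff)

text \<open>The sets on which local representations are smooth are images of point sets; this describes them by their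
  coordinates.\<close>

lemma mem_overlap_iff:
  assumes "smooth_manifold S" "i \<in> cidx S"
  shows "y \<in> coord S i ` (cdom S i \<inter> \<psi> -` A) \<longleftrightarrow> y \<in> cimg S i \<and> \<psi> (param S i y) \<in> A"
proof
  assume "y \<in> coord S i ` (cdom S i \<inter> \<psi> -` A)"
  then obtain p where "p \<in> cdom S i" "\<psi> p \<in> A" "y = coord S i p" by blast
  then show "y \<in> cimg S i \<and> \<psi> (param S i y) \<in> A"
    using param_coord[OF assms] by (auto simp: cimg_def)
next
  assume "y \<in> cimg S i \<and> \<psi> (param S i y) \<in> A"
  then show "y \<in> coord S i ` (cdom S i \<inter> \<psi> -` A)"
    using coord_param[of y S i] by (intro image_eqI[of _ _ "param S i y"]) auto
qed

lemma local_rep_in_cimg: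
  assumes "smooth_manifold S" "i \<in> cidx S" "y \<in> coord S i ` (cdom S i \<inter> \<psi> -` cdom N j)"
  shows "y \<in> cimg S i" "local_rep S N \<psi> i j y \<in> cimg N j"
  using assms(3) unfolding mem_overlap_iff[OF assms(1,2)] by (auto simp: local_rep_def cimg_def)

lemma chosen_charts:
  assumes S: "smooth_manifold S" and N: "smooth_manifold N" and \<psi>: "smooth_map S N \<psi>"
    and p: "p \<in> topspace (mtop S)"
  shows "chart_at S p \<in> cidx S" "chart_at N (\<psi> p) \<in> cidx N"
    "coord S (chart_at S p) p \<in> coord S (chart_at S p) `
       (cdom S (chart_at S p) \<inter> \<psi> -` cdom N (chart_at N (\<psi> p)))"
proof -
  have "\<psi> p \<in> topspace (mtop N)" using \<psi> p by (auto simp: smooth_map_def continuous_map_def)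
  then show "chart_at S p \<in> cidx S" "chart_at N (\<psi> p) \<in> cidx N"
    "coord S (chart_at S p) p \<in> coord S (chart_at S p) `
       (cdom S (chart_at S p) \<inter> \<psi> -` cdom N (chart_at N (\<psi> p)))"
    using chart_at[OF S p] chart_at[OF N] by auto
qed

text \<open>The induced metric is defined with the chart that is chosen at the image of each point, and this choice may
  change from point to point. Differentiating it requires one chart of the target that works near
  the given point.\<close>

lemma gmet_induced:
  assumes S: "smooth_manifold S" and N: "smooth_manifold N" "metric_tensor N"
    and \<psi>: "smooth_map S N \<psi>" and i: "i \<in> cidx S" and j: "j \<in> cidx N"
    and y: "y \<in> coord S i ` (cdom S i \<inter> \<psi> -` cdom N j)"
  shows "gmet (induced S N \<psi>) i y v w = gmet N j (local_rep S N \<psi> i j y)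
     (frechet_derivative (local_rep S N \<psi> i j) (at y) v)
     (frechet_derivative (local_rep S N \<psi> i j) (at y) w)"
proof -
  let ?q = "\<psi> (param S i y)"
  define k where "k = chart_at N ?q"
  let ?W = "\<lambda>j. coord S i ` (cdom S i \<inter> \<psi> -` cdom N j)"
  let ?F = "local_rep S N \<psi> i" and ?\<tau> = "local_rep N N id j k"
  have cont: "continuous_map (mtop S) (mtop N) \<psi>" using \<psi> by (simp add: smooth_map_def)
  note W = mem_overlap_iff[OF S i]
  have y': "y \<in> cimg S i" "?q \<in> cdom N j" using y unfolding W by auto
  have q: "?q \<in> topspace (mtop N)" using cdom_subset_topspace[OF N(1) j] y'(2) by blast
  have k: "k \<in> cidx N" "?q \<in> cdom N k" using chart_at[OF N(1) q] by (simp_all add: k_def)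
  have yk: "y \<in> ?W k" using y' k(2) W by blast
  have op: "open (?W j \<inter> ?W k)" using open_chart_overlap[OF S i N(1) _ cont] j k(1) by blast
  have F: "smooth_on (?W j) (?F j)" using \<psi> i j unfolding smooth_map_def by blast
  have Fy: "?F j y \<in> coord N j ` (cdom N j \<inter> cdom N k)"
    using y'(2) k(2) by (auto simp: local_rep_def)
  have \<tau>F: "?\<tau> (?F j x) = ?F k x" if "x \<in> ?W j \<inter> ?W k" for x
    using that[unfolded Int_iff W] param_coord[OF N(1) j] by (simp add: local_rep_def)
  have "((\<lambda>x. ?\<tau> (?F j x)) has_derivative
      (\<lambda>h. frechet_derivative ?\<tau> (at (?F j y)) (frechet_derivative (?F j) (at y) h))) (at y)"
    using has_derivative_compose[OF smooth_onD(1)[OF F y, unfolded frechet_derivative_works]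
        smooth_onD(1)[OF smooth_transition[OF N(1) j k(1)] Fy, unfolded frechet_derivative_works]] .
  then have "(?F k has_derivative
      (\<lambda>h. frechet_derivative ?\<tau> (at (?F j y)) (frechet_derivative (?F j) (at y) h))) (at y)"
    by (rule has_derivative_transform_within_open[OF _ op]) (use y yk \<tau>F in auto)
  from frechet_derivative_at[OF this, symmetric]
  have "frechet_derivative (?F k) (at y) =
      (\<lambda>h. frechet_derivative ?\<tau> (at (?F j y)) (frechet_derivative (?F j) (at y) h))" .
  then show ?thesis
    unfolding gmet_transition[OF N(2) j k(1) Fy] \<tau>F[OF IntI[OF y yk]]
    by (simp add: induced_def k_def Let_def)
qed

text \<open>Gauss's formula. By Koszul's formula for both connections and the product rule for the induced
  metric, \<open>\<langle>d\<psi>(\<nabla>\<^sup>S\<^sub>V W), d\<psi> Z\<rangle>\<close> equals \<open>\<langle>\<nabla>\<^sup>N\<^sub>V d\<psi> W, d\<psi> Z\<rangle>\<close>; the remaining second derivatives of \<open>\<psi>\<close>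
  cancel because they are symmetric.\<close>

lemma second_ff_normal:
  assumes S: "smooth_manifold S" and N: "smooth_manifold N" "metric_tensor N"
    and \<psi>: "smooth_map S N \<psi>" and R: "riemannian (induced S N \<psi>)"
    and i: "i \<in> cidx S" and j: "j \<in> cidx N"
    and y: "y \<in> coord S i ` (cdom S i \<inter> \<psi> -` cdom N j)"
  shows "gmet N j (local_rep S N \<psi> i j y) (second_ff S N \<psi> i j y v w)
    (frechet_derivative (local_rep S N \<psi> i j) (at y) z) = 0"
proof -
  let ?R = "induced S N \<psi>" and ?F = "local_rep S N \<psi> i j"
  let ?D = "\<lambda>x. frechet_derivative ?F (at x)"
  let ?D2 = "\<lambda>h v. frechet_derivative (\<lambda>x. ?D x v) (at y) h"
  let ?W = "coord S i ` (cdom S i \<inter> \<psi> -` cdom N j)"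
  let ?g = "gmet N j (?F y)" and ?dg = "\<lambda>a b. frechet_derivative (\<lambda>q. gmet N j q a b) (at (?F y))"
  have cont: "continuous_map (mtop S) (mtop N) \<psi>" using \<psi> by (simp add: smooth_map_def)
  have op: "open ?W" by (rule open_chart_overlap[OF S i N(1) j cont])
  have F: "smooth_on ?W ?F" using \<psi> i j unfolding smooth_map_def by blast
  note y' = local_rep_in_cimg(1)[OF S i y] and q = local_rep_in_cimg(2)[OF S i y]
  have R': "smooth_manifold ?R" "metric_tensor ?R" using R by (auto simp: riemannian_def)
  note bil = bilinear_gmet[OF N(2) j q]
  have dF: "(?F has_derivative ?D y) (at y)" and dD: "((\<lambda>x. ?D x v) has_derivative (\<lambda>h. ?D2 h v)) (at y)" for v
    using smooth_onD[OF F y] by (simp_all add: frechet_derivative_works[symmetric])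
  have sym: "?D2 h v = ?D2 v h" for h v
    by (rule symmetric_second_derivative[OF F op y])
  have dR: "frechet_derivative (\<lambda>x. gmet ?R i x v w) (at y) h
      = ?dg (?D y v) (?D y w) (?D y h) + ?g (?D2 h v) (?D y w) + ?g (?D y v) (?D2 h w)" for v w h
  proof -
    have "((\<lambda>x. gmet N j (?F x) (?D x v) (?D x w)) has_derivative
        (\<lambda>h. ?dg (?D y v) (?D y w) (?D y h) + ?g (?D2 h v) (?D y w) + ?g (?D y v) (?D2 h w))) (at y)"
      by (rule has_derivative_bilinear_field[where B = "gmet N j" and U = "cimg N j" and q = "?F y"])
        (use open_cimg[OF N(1) j] q bilinear_gmet(1)[OF N(2) j] gmet_derivative[OF N j q] dF dD in simp_all)
    then have "((\<lambda>x. gmet ?R i x v w) has_derivative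
        (\<lambda>h. ?dg (?D y v) (?D y w) (?D y h) + ?g (?D2 h v) (?D y w) + ?g (?D y v) (?D2 h w))) (at y)"
      by (rule has_derivative_transform_within_open[OF _ op y])
        (rule gmet_induced[OF S N \<psi> i j, symmetric])
    from fun_cong[OF frechet_derivative_at[OF this], of h] show ?thesis by simp
  qed
  have "2 * ?g (?D y (christoffel ?R i y v w)) (?D y z) = 2 * gmet ?R i y (christoffel ?R i y v w) z"
    using gmet_induced[OF S N \<psi> i j y] by simp
  also have "\<dots> = frechet_derivative (\<lambda>x. gmet ?R i x w z) (at y) v
      + frechet_derivative (\<lambda>x. gmet ?R i x v z) (at y) w
      - frechet_derivative (\<lambda>x. gmet ?R i x v w) (at y) z"
    by (rule gmet_christoffel[OF R']) (use i y' in simp_all)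
  also have "\<dots> = 2 * ?g (christoffel N j (?F y) (?D y v) (?D y w)) (?D y z) + 2 * ?g (?D2 v w) (?D y z)"
    unfolding dR gmet_christoffel[OF N j q, of "?D y v" "?D y w" "?D y z"]
    using sym[of w v] sym[of z v] sym[of w z] bil(2)[of "?D y w" "?D2 v z"] bil(2)[of "?D y v" "?D2 z w"]
    by simp
  finally show ?thesis
    unfolding second_ff_def Let_def by (simp add: bilinear_ladd[OF bil(1)] bilinear_lsub[OF bil(1)])
qed

lemma mean_curvature_vector_normal:
  assumes S: "smooth_manifold S" and N: "smooth_manifold N" "metric_tensor N"
    and \<psi>: "smooth_map S N \<psi>" and R: "riemannian (induced S N \<psi>)"
    and i: "i \<in> cidx S" and j: "j \<in> cidx N"
    and y: "y \<in> coord S i ` (cdom S i \<inter> \<psi> -` cdom N j)"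
  shows "gmet N j (local_rep S N \<psi> i j y) (mean_curvature_vector S N \<psi> i j y)
    (frechet_derivative (local_rep S N \<psi> i j) (at y) z) = 0"
proof -
  let ?g = "gmet N j (local_rep S N \<psi> i j y)" and ?d = "frechet_derivative (local_rep S N \<psi> i j) (at y) z"
  note bil = bilinear_gmet(1)[OF N(2) j local_rep_in_cimg(2)[OF S i y]]
  have lin: "linear (\<lambda>x. ?g x ?d)" using bil by (simp add: bilinear_def)
  show ?thesis
    unfolding mean_curvature_vector_def metric_trace_def linear_cmul[OF lin] linear_sum[OF lin]
    by (simp add: second_ff_normal[OF assms])
qed

text \<open>The defining descriptions of the unit normal and of the mean curvature do determine them, given any
  field \<open>T\<close> that is lightlike at the point. The third part is the transversality that makes this
  possible; it is also what keeps \<open>u\<close> from being constant on the hypersurface.\<close>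

lemma mean_curvature_vector_eq:
  assumes hyp: "spacelike_hypersurface S N \<psi>" and N: "smooth_manifold N" "metric_tensor N"
    and p: "p \<in> topspace (mtop S)" and i: "i = chart_at S p" and j: "j = chart_at N (\<psi> p)"
    and y: "y = coord S i p"
    and T: "gmet N j (local_rep S N \<psi> i j y) (T j (local_rep S N \<psi> i j y)) (T j (local_rep S N \<psi> i j y)) = 0"
      "T j (local_rep S N \<psi> i j y) \<noteq> 0"
  shows "mean_curvature_vector S N \<psi> i j y = mean_curvature S N \<psi> T p *\<^sub>R unit_normal S N \<psi> T i j y"
    and "gmet N j (local_rep S N \<psi> i j y) (unit_normal S N \<psi> T i j y) (T j (local_rep S N \<psi> i j y)) < 0"
    and "\<exists>w. gmet N j (local_rep S N \<psi> i j y) (T j (local_rep S N \<psi> i j y))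
            (frechet_derivative (local_rep S N \<psi> i j) (at y) w) \<noteq> 0"
proof -
  let ?F = "local_rep S N \<psi> i j"
  let ?g = "gmet N j (?F y)" and ?D = "frechet_derivative ?F (at y)" and ?T = "T j (?F y)"
  have S: "smooth_manifold S" and \<psi>: "smooth_map S N \<psi>" and R: "riemannian (induced S N \<psi>)"
    using hyp by (auto simp: spacelike_hypersurface_def connected_manifold_def immersion_def)
  note ij = chosen_charts(1,2)[OF S N(1) \<psi> p, folded i j]
  note y' = chosen_charts(3)[OF S N(1) \<psi> p, folded i j, folded y]
  note yi = local_rep_in_cimg(1)[OF S ij(1) y'] and q = local_rep_in_cimg(2)[OF S ij(1) y']
  note g = bilinear_gmet[OF N(2) ij(2) q]
  have "smooth_on (coord S i ` (cdom S i \<inter> \<psi> -` cdom N j)) ?F"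
    using \<psi> ij unfolding smooth_map_def by blast
  then have D: "linear ?D" using linear_frechet_derivative smooth_onD(1) y' by blast
  have inj: "inj ?D" using hyp ij y' unfolding spacelike_hypersurface_def immersion_def by blast
  have dim: "DIM('f) = DIM('c) + 1" using hyp by (simp add: spacelike_hypersurface_def)
  have pos: "0 < ?g (?D w) (?D w)" if "w \<noteq> 0" for w
  proof -
    have "0 < gmet (induced S N \<psi>) i y w w" using R ij(1) yi that by (simp add: riemannian_def)
    then show ?thesis unfolding gmet_induced[OF S N \<psi> ij y'] .
  qed
  show "\<exists>w. ?g ?T (?D w) \<noteq> 0"
    by (rule lightlike_not_normal[OF D inj dim g(1,3) pos T])
  obtain \<nu> where \<nu>: "\<And>w. ?g \<nu> (?D w) = 0" "?g \<nu> \<nu> = -1" "?g \<nu> ?T < 0"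
    and normal: "\<And>x. (\<forall>w. ?g x (?D w) = 0) \<Longrightarrow> \<exists>a. x = a *\<^sub>R \<nu>"
    using unit_normal_exists[OF D inj dim g(1,3,2) pos T] by blast
  have \<nu>_eq: "unit_normal S N \<psi> T i j y = \<nu>"
    unfolding unit_normal_def Let_def
  proof (rule the_equality)
    fix \<nu>' assume a: "(\<forall>w. ?g \<nu>' (?D w) = 0) \<and> ?g \<nu>' \<nu>' = - 1 \<and> ?g \<nu>' ?T < 0"
    then obtain a where \<nu>': "\<nu>' = a *\<^sub>R \<nu>" using normal by blast
    have "a * a = 1" using a \<nu>(2) by (simp add: \<nu>' bilinear_lmul[OF g(1)] bilinear_rmul[OF g(1)])
    moreover have "a > 0"
      using a \<nu>(3) by (simp add: \<nu>' bilinear_lmul[OF g(1)] mult_less_0_iff)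
    ultimately have "a = 1" by (auto simp: square_eq_1_iff)
    then show "\<nu>' = \<nu>" using \<nu>' by simp
  qed (use \<nu> in auto)
  obtain h where h: "mean_curvature_vector S N \<psi> i j y = h *\<^sub>R \<nu>"
    using normal mean_curvature_vector_normal[OF S N \<psi> R ij y'] by blast
  have "\<nu> \<noteq> 0" using \<nu>(2) bilinear_lzero[OF g(1)] by auto
  then have "mean_curvature S N \<psi> T p = h"
    unfolding mean_curvature_def Let_def
    using h by (intro the_equality) (simp_all add: i[symmetric] j[symmetric] y[symmetric] \<nu>_eq)
  then show "mean_curvature_vector S N \<psi> i j y = mean_curvature S N \<psi> T p *\<^sub>R unit_normal S N \<psi> T i j y"
    using h \<nu>_eq by simp
  show "?g (unit_normal S N \<psi> T i j y) ?T < 0" using \<nu>(3) \<nu>_eq by simp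
qed


section \<open>The wave coordinate on a spacelike hypersurface\<close>

text \<open>The field \<open>\<partial>\<^sub>v\<close> is the gradient of \<open>u\<close>: it is metrically dual to \<open>du\<close>.\<close>

lemma gmet_plane_wave_d_v:
  assumes "metric_tensor (plane_wave M \<H>)" "j \<in> cidx (plane_wave M \<H>)" "q \<in> cimg (plane_wave M \<H>) j"
  shows "gmet (plane_wave M \<H>) j q X (d_v j' q') = fst (fst X)"
    "gmet (plane_wave M \<H>) j q (d_v j' q') X = fst (fst X)"
proof -
  show 1: "gmet (plane_wave M \<H>) j q X (d_v j' q') = fst (fst X)" for X
    using gmet_plane_wave[of M \<H> j q X "0"] bilinear_rzero[OF bilinear_gmet(1)[OF assms], of X]
    by (simp add: gmet_plane_wave d_v_def)
  then show "gmet (plane_wave M \<H>) j q (d_v j' q') X = fst (fst X)"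
    by (simp add: bilinear_gmet(2)[OF assms])
qed

text \<open>This says that \<open>\<partial>\<^sub>v\<close> is parallel, in the form that is needed. In Koszul's formula for the product of
  \<open>\<nabla>\<^sub>X Y\<close> with \<open>\<partial>\<^sub>v\<close>, two terms differentiate the constant functions \<open>du(X)\<close> and \<open>du(Y)\<close>, and the third
  differentiates the metric along \<open>v\<close>, on which it does not depend.\<close>

lemma christoffel_plane_wave_du:
  assumes M: "smooth_manifold M" "metric_tensor M"
    and N: "metric_tensor (plane_wave M \<H>)" and j: "j \<in> cidx M" and q: "q \<in> cimg (plane_wave M \<H>) j"
  shows "fst (fst (christoffel (plane_wave M \<H>) j q X Y)) = 0"
proof -
  let ?N = "plane_wave M \<H>" and ?V = "d_v j q"
  note smN = smooth_manifold_plane_wave[OF M(1), of \<H>]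
  have j': "j \<in> cidx ?N" using j by simp
  have const: "frechet_derivative (\<lambda>x. gmet ?N j x Z ?V) (at q) h = 0" for Z h
  proof -
    have "((\<lambda>x. gmet ?N j x Z ?V) has_derivative (\<lambda>h. 0)) (at q)"
      by (rule has_derivative_transform_within_open[OF has_derivative_const[of "fst (fst Z)"]
            open_cimg[OF smN j'] q])
        (rule gmet_plane_wave_d_v(1)[OF N j', symmetric])
    from fun_cong[OF frechet_derivative_at[OF this], of h] show ?thesis by simp
  qed
  have v_indep: "frechet_derivative (\<lambda>x. gmet ?N j x X Y) (at q) ?V = 0"
  proof -
    let ?f = "\<lambda>x. gmet ?N j x X Y"
    \<comment> \<open>The function is constant along the line in direction \<open>\<partial>\<^sub>v\<close>.\<close>
    have line: "((\<lambda>t. q + t *\<^sub>R ?V) has_derivative (\<lambda>t. t *\<^sub>R ?V)) (at 0)"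
      by (auto intro!: derivative_eq_intros)
    have "(?f has_derivative frechet_derivative ?f (at q)) (at (q + 0 *\<^sub>R ?V))"
      using gmet_derivative[OF smN N j' q, of X Y] by simp
    from has_derivative_compose[OF line this]
    have 1: "((\<lambda>t. ?f (q + t *\<^sub>R ?V)) has_derivative (\<lambda>t. frechet_derivative ?f (at q) (t *\<^sub>R ?V))) (at 0)" .
    have "(\<lambda>t. ?f (q + t *\<^sub>R ?V)) = (\<lambda>t. ?f q)"
      by (simp add: gmet_plane_wave d_v_def)
    then have "((\<lambda>t. ?f (q + t *\<^sub>R ?V)) has_derivative (\<lambda>t. 0)) (at 0)" by simp
    from fun_cong[OF has_derivative_unique[OF 1 this], of 1] show ?thesis by simp
  qed
  have "fst (fst (christoffel ?N j q X Y)) = gmet ?N j q (christoffel ?N j q X Y) ?V"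
    by (simp add: gmet_plane_wave_d_v(1)[OF N j' q])
  also have "\<dots> = 0"
    using gmet_christoffel[OF smN N j' q, of X Y ?V] const v_indep by simp
  finally show ?thesis .
qed

text \<open>The factor \<open>c\<close> lets \<open>\<mu>\<close> and \<open>-\<mu>\<close> be treated together.\<close>

lemma u_coord_rep:
  "(\<lambda>p. c * u_coord (\<psi> p)) \<circ> param S i
     = (\<lambda>x. c * fst (fst (local_rep S (plane_wave M \<H>) \<psi> i j x)))"
  by (simp add: local_rep_def u_coord_def case_prod_beta fun_eq_iff)

lemma linear_u: "linear (\<lambda>z :: (real \<times> real) \<times> 'e::euclidean_space. c * fst (fst z))"
  by (rule linearI) (simp_all add: algebra_simps)

lemma smooth_fun_u_coord:
  assumes S: "smooth_manifold S" and M: "smooth_manifold M"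
    and \<psi>: "smooth_map S (plane_wave M \<H>) \<psi>"
  shows "smooth_fun S (\<lambda>p. c * u_coord (\<psi> p))"
  unfolding smooth_fun_def smooth_on_def
proof (intro ballI allI C_on_locally)
  fix i k x assume i: "i \<in> cidx S" and x: "x \<in> cimg S i"
  let ?N = "plane_wave M \<H>"
  note N = smooth_manifold_plane_wave[OF M, of \<H>]
  have cont: "continuous_map (mtop S) (mtop ?N) \<psi>" using \<psi> by (simp add: smooth_map_def)
  have "param S i x \<in> topspace (mtop S)"
    using coord_param(1)[OF x] cdom_subset_topspace[OF S i] by blast
  then have "\<psi> (param S i x) \<in> topspace (mtop ?N)" using cont by (auto simp: continuous_map_def)
  note j = chart_at[OF N this]
  let ?j = "chart_at ?N (\<psi> (param S i x))"
  let ?W = "coord S i ` (cdom S i \<inter> \<psi> -` cdom ?N ?j)"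
  have op: "open ?W" by (rule open_chart_overlap[OF S i N j(1) cont])
  have "C_on k ?W (local_rep S ?N \<psi> i ?j)"
    using \<psi> i j(1) unfolding smooth_map_def smooth_on_def by blast
  from C_on_linear_comp[OF op linear_u this]
  have "C_on k ?W ((\<lambda>p. c * u_coord (\<psi> p)) \<circ> param S i)"
    unfolding u_coord_rep[of c \<psi> S i M \<H> ?j] .
  moreover have "x \<in> ?W" using x j(2) mem_overlap_iff[OF S i] by blast
  ultimately show "\<exists>U. open U \<and> x \<in> U \<and> C_on k U ((\<lambda>p. c * u_coord (\<psi> p)) \<circ> param S i)"
    using op by blast
qed

text \<open>Both sides are \<open>c du\<close> applied to the second derivative of \<open>\<psi>\<close> minus \<open>d\<psi>(\<nabla>\<^sup>S\<^sub>V W)\<close>: the term with the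
  connection of the wave in \<open>II\<close> is killed by \<open>du\<close>.\<close>

lemma hessian_u_coord:
  fixes M :: "('i, 'm, 'e::euclidean_space) rmfd"
  assumes S: "smooth_manifold S" and M: "smooth_manifold M" "metric_tensor M"
    and N: "metric_tensor (plane_wave M \<H>)"
    and \<psi>: "smooth_map S (plane_wave M \<H>) \<psi>" and i: "i \<in> cidx S" and j: "j \<in> cidx M"
    and y: "y \<in> coord S i ` (cdom S i \<inter> \<psi> -` cdom (plane_wave M \<H>) j)"
  shows "hessian (induced S (plane_wave M \<H>) \<psi>) i (\<lambda>p. c * u_coord (\<psi> p)) y v w
     = c * fst (fst (second_ff S (plane_wave M \<H>) \<psi> i j y v w))"
proof -
  let ?N = "plane_wave M \<H>" and ?f = "\<lambda>p. c * u_coord (\<psi> p)"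
  let ?F = "local_rep S ?N \<psi> i j" and ?l = "\<lambda>z :: (real \<times> real) \<times> 'e. c * fst (fst z)"
  let ?D = "\<lambda>x. frechet_derivative ?F (at x)"
  let ?W = "coord S i ` (cdom S i \<inter> \<psi> -` cdom ?N j)"
  note smN = smooth_manifold_plane_wave[OF M(1), of \<H>]
  have j': "j \<in> cidx ?N" using j by simp
  have op: "open ?W"
    by (rule open_chart_overlap[OF S i smN j']) (use \<psi> in \<open>simp add: smooth_map_def\<close>)
  have F: "smooth_on ?W ?F" using \<psi> i j' unfolding smooth_map_def by blast
  note q = local_rep_in_cimg(2)[OF S i y]
  have D: "frechet_derivative (?f \<circ> param S i) (at x) z = ?l (?D x z)" if "x \<in> ?W" for x z
    unfolding u_coord_rep[of c \<psi> S i M \<H> j]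
    by (rule frechet_derivative_linear_comp[OF linear_u smooth_onD(1)[OF F that]])
  have "((\<lambda>x. ?l (?D x w)) has_derivative (\<lambda>h. ?l (frechet_derivative (\<lambda>x. ?D x w) (at y) h))) (at y)"
    by (rule has_derivative_linear_comp[OF linear_u smooth_onD(2)[OF F y, unfolded frechet_derivative_works]])
  then have "((\<lambda>x. frechet_derivative (?f \<circ> param S i) (at x) w) has_derivative
      (\<lambda>h. ?l (frechet_derivative (\<lambda>x. ?D x w) (at y) h))) (at y)"
    by (rule has_derivative_transform_within_open[OF _ op y]) (rule D[symmetric])
  from fun_cong[OF frechet_derivative_at[OF this], of v] show ?thesis
    unfolding hessian_def second_ff_def Let_def
    using D[OF y] christoffel_plane_wave_du[OF M N j q] by (simp add: algebra_simps)
qed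

text \<open>The factor is \<open>k = - (n + 1) \<langle>N, \<partial>\<^sub>v\<rangle>\<close>, where \<open>n + 1\<close> is the dimension of the hypersurface.\<close>

lemma laplacian_u_coord:
  fixes S :: "('j, 's, 'd::euclidean_space) mfd" and M :: "('i, 'm, 'e::euclidean_space) rmfd"
  assumes M: "smooth_manifold M" "metric_tensor M"
    and N: "metric_tensor (plane_wave M \<H>)"
    and hyp: "spacelike_hypersurface S (plane_wave M \<H>) \<psi>" and p: "p \<in> topspace (mtop S)"
  shows "\<exists>k>0. laplacian (induced S (plane_wave M \<H>) \<psi>) (\<lambda>p. c * u_coord (\<psi> p)) p
      = - (k * c * mean_curvature S (plane_wave M \<H>) \<psi> d_v p)"
proof -
  let ?N = "plane_wave M \<H>" and ?R = "induced S (plane_wave M \<H>) \<psi>"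
  let ?f = "\<lambda>p. c * u_coord (\<psi> p)"
  define i j y where "i = chart_at S p" and "j = chart_at ?N (\<psi> p)" and "y = coord S i p"
  let ?q = "local_rep S ?N \<psi> i j y" and ?H = "mean_curvature S ?N \<psi> d_v p"
  let ?\<nu> = "unit_normal S ?N \<psi> d_v i j y"
  note smN = smooth_manifold_plane_wave[OF M(1), of \<H>]
  have S: "smooth_manifold S" and \<psi>: "smooth_map S ?N \<psi>" and R: "riemannian ?R"
    using hyp by (auto simp: spacelike_hypersurface_def connected_manifold_def immersion_def)
  note ij = chosen_charts(1,2)[OF S smN \<psi> p, folded i_def j_def]
  note y = chosen_charts(3)[OF S smN \<psi> p, folded i_def j_def, folded y_def]
  note g = gmet_plane_wave_d_v[OF N ij(2) local_rep_in_cimg(2)[OF S ij(1) y]]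
  have T: "gmet ?N j ?q (d_v j ?q) (d_v j ?q) = 0" "d_v j ?q \<noteq> 0"
    unfolding g(1) by (simp_all add: d_v_def zero_prod_def)
  note H = mean_curvature_vector_eq[OF hyp smN N p i_def j_def y_def, of d_v, OF T]
  have yi: "y \<in> cimg ?R i" using local_rep_in_cimg(1)[OF S ij(1) y] by simp
  have "laplacian ?R ?f p = divergence ?R i (gradient ?R i ?f) y"
    by (simp add: laplacian_def Let_def i_def y_def)
  also have "\<dots> = metric_trace (gmet ?R i y) (hessian ?R i ?f y)"
    by (rule divergence_gradient)
      (use R ij(1) yi smooth_fun_u_coord[OF S M(1) \<psi>, of c] in \<open>auto simp: riemannian_def smooth_fun_def\<close>)
  also have "\<dots> = c * fst (fst (metric_trace (gmet ?R i y) (second_ff S ?N \<psi> i j y)))"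
  proof -
    have "hessian ?R i ?f y v w = c * fst (fst (second_ff S ?N \<psi> i j y v w))" for v w
      by (rule hessian_u_coord[OF S M N \<psi> ij(1) _ y]) (use ij(2) in simp)
    then show ?thesis
      unfolding metric_trace_def fst_sum by (simp add: sum_distrib_left)
  qed
  also have "\<dots> = c * (DIM('d) * fst (fst (mean_curvature_vector S ?N \<psi> i j y)))"
    by (simp add: mean_curvature_vector_def)
  also have "\<dots> = c * (DIM('d) * (?H * gmet ?N j ?q ?\<nu> (d_v j ?q)))"
    unfolding H(1) g by simp
  finally have "laplacian ?R ?f p = - ((DIM('d) * - gmet ?N j ?q ?\<nu> (d_v j ?q)) * c * ?H)" by simp
  moreover have "DIM('d) * - gmet ?N j ?q ?\<nu> (d_v j ?q) > 0"
    using H(2) by (intro mult_pos_pos) simp_all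
  ultimately show ?thesis by blast
qed

text \<open>A constant \<open>\<mu>\<close> would make \<open>\<langle>\<partial>\<^sub>v, d\<psi> W\<rangle> = d\<mu>(W)\<close> vanish, so that \<open>\<partial>\<^sub>v\<close> would be normal.\<close>

lemma u_coord_not_constant:
  fixes S :: "('j, 's, 'd::euclidean_space) mfd" and M :: "('i, 'm, 'e::euclidean_space) rmfd"
  assumes M: "smooth_manifold M" "metric_tensor M"
    and N: "metric_tensor (plane_wave M \<H>)"
    and hyp: "spacelike_hypersurface S (plane_wave M \<H>) \<psi>" and c: "c \<noteq> 0"
  shows "\<not> (\<lambda>p. c * u_coord (\<psi> p)) constant_on topspace (mtop S)"
proof
  let ?N = "plane_wave M \<H>" and ?f = "\<lambda>p. c * u_coord (\<psi> p)"
  assume "?f constant_on topspace (mtop S)"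
  then obtain k where k: "\<And>p. p \<in> topspace (mtop S) \<Longrightarrow> ?f p = k" unfolding constant_on_def by blast
  have S: "smooth_manifold S" and \<psi>: "smooth_map S ?N \<psi>"
    using hyp by (auto simp: spacelike_hypersurface_def connected_manifold_def immersion_def)
  obtain p where p: "p \<in> topspace (mtop S)"
    using hyp unfolding spacelike_hypersurface_def connected_manifold_def by blast
  define i j y where "i = chart_at S p" and "j = chart_at ?N (\<psi> p)" and "y = coord S i p"
  let ?F = "local_rep S ?N \<psi> i j"
  note smN = smooth_manifold_plane_wave[OF M(1), of \<H>]
  note ij = chosen_charts(1,2)[OF S smN \<psi> p, folded i_def j_def]
  note y = chosen_charts(3)[OF S smN \<psi> p, folded i_def j_def, folded y_def]
  note g = gmet_plane_wave_d_v[OF N ij(2) local_rep_in_cimg(2)[OF S ij(1) y]]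
  have T: "gmet ?N j (?F y) (d_v j (?F y)) (d_v j (?F y)) = 0" "d_v j (?F y) \<noteq> 0"
    unfolding g(1) by (simp_all add: d_v_def zero_prod_def)
  note H = mean_curvature_vector_eq[OF hyp smN N p i_def j_def y_def, of d_v, OF T]
  from H(3) obtain w where w: "fst (fst (frechet_derivative ?F (at y) w)) \<noteq> 0" by (auto simp: g)
  note yi = local_rep_in_cimg(1)[OF S ij(1) y]
  have "(?f \<circ> param S i) x = k" if "x \<in> cimg S i" for x
    using k coord_param(1)[OF that] cdom_subset_topspace[OF S ij(1)] by auto
  then have "((?f \<circ> param S i) has_derivative (\<lambda>h. 0)) (at y)"
    by (intro has_derivative_transform_within_open[OF has_derivative_const[of k] open_cimg[OF S ij(1)] yi]) simp
  from fun_cong[OF frechet_derivative_at[OF this], of w]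
  have "frechet_derivative (?f \<circ> param S i) (at y) w = 0" by simp
  moreover have "smooth_on (coord S i ` (cdom S i \<inter> \<psi> -` cdom ?N j)) ?F"
    using \<psi> ij unfolding smooth_map_def by blast
  then have "frechet_derivative (?f \<circ> param S i) (at y) w = c * fst (fst (frechet_derivative ?F (at y) w))"
    unfolding u_coord_rep[of c \<psi> S i M \<H> j]
    by (intro frechet_derivative_linear_comp[OF linear_u smooth_onD(1)[OF _ y]])
  ultimately show False using w c by simp
qed

text \<open>With \<open>c = -1\<close> and \<open>c = 1\<close> this covers the two sign conditions on the mean curvature.\<close>

lemma no_parabolic_hypersurface:
  assumes wave: "plane_fronted_wave M \<H>"
    and hyp: "spacelike_hypersurface S (plane_wave M \<H>) \<psi>"
    and par: "parabolic (induced S (plane_wave M \<H>) \<psi>)" and c: "c \<noteq> 0"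
    and H: "\<forall>p\<in>topspace (mtop S). 0 \<le> c * mean_curvature S (plane_wave M \<H>) \<psi> d_v p"
    and bdd: "bdd_below ((\<lambda>p. c * u_coord (\<psi> p)) ` topspace (mtop S))"
  shows False
proof -
  let ?N = "plane_wave M \<H>" and ?f = "\<lambda>p. c * u_coord (\<psi> p)"
  have M: "smooth_manifold M" "metric_tensor M"
    using wave by (auto simp: plane_fronted_wave_def riemannian_def)
  have N: "metric_tensor ?N"
    using metric_tensor_plane_wave[OF M] wave by (simp add: plane_fronted_wave_def)
  have S: "smooth_manifold S" and \<psi>: "smooth_map S ?N \<psi>"
    using hyp by (auto simp: spacelike_hypersurface_def connected_manifold_def immersion_def)
  have "laplacian (induced S ?N \<psi>) ?f p \<le> 0" if p: "p \<in> topspace (mtop S)" for p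
  proof -
    obtain k where "k > 0" "laplacian (induced S ?N \<psi>) ?f p = - (k * c * mean_curvature S ?N \<psi> d_v p)"
      using laplacian_u_coord[OF M N hyp p] by blast
    then show ?thesis using H p by (simp add: mult.assoc)
  qed
  moreover have "smooth_fun (induced S ?N \<psi>) ?f"
    using smooth_fun_u_coord[OF S M(1) \<psi>, of c] by (simp add: smooth_fun_def)
  ultimately have "?f constant_on topspace (mtop S)"
    using par bdd unfolding parabolic_def by simp
  then show False using u_coord_not_constant[OF M N hyp c] by blast
qed

theorem corollary13:
  fixes M :: "('i, 'm, 'e::euclidean_space) rmfd" and \<H> :: "real \<Rightarrow> 'm \<Rightarrow> real"
  assumes "plane_fronted_wave M \<H>"
  shows "(\<nexists>(S :: ('j, 's, 'd::euclidean_space) mfd) \<psi>.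
            spacelike_hypersurface S (plane_wave M \<H>) \<psi> \<and>
            parabolic (induced S (plane_wave M \<H>) \<psi>) \<and>
            (\<forall>p\<in>topspace (mtop S). mean_curvature S (plane_wave M \<H>) \<psi> d_v p \<le> 0) \<and>
            bdd_above ((u_coord \<circ> \<psi>) ` topspace (mtop S))) \<and>
         (\<nexists>(S :: ('j, 's, 'd) mfd) \<psi>.
            spacelike_hypersurface S (plane_wave M \<H>) \<psi> \<and>
            parabolic (induced S (plane_wave M \<H>) \<psi>) \<and>
            (\<forall>p\<in>topspace (mtop S). mean_curvature S (plane_wave M \<H>) \<psi> d_v p \<ge> 0) \<and>
            bdd_below ((u_coord \<circ> \<psi>) ` topspace (mtop S)))"
proof (intro conjI notI; elim exE conjE)
  fix S :: "('j, 's, 'd) mfd" and \<psi>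
  assume hyp: "spacelike_hypersurface S (plane_wave M \<H>) \<psi>" "parabolic (induced S (plane_wave M \<H>) \<psi>)"
  {
    assume "\<forall>p\<in>topspace (mtop S). mean_curvature S (plane_wave M \<H>) \<psi> d_v p \<le> 0"
      "bdd_above ((u_coord \<circ> \<psi>) ` topspace (mtop S))"
    moreover from this(2) obtain B where "\<And>p. p \<in> topspace (mtop S) \<Longrightarrow> u_coord (\<psi> p) \<le> B"
      by (auto simp: bdd_above_def)
    then have "bdd_below ((\<lambda>p. - 1 * u_coord (\<psi> p)) ` topspace (mtop S))"
      by (intro bdd_belowI2[of _ "- B"]) simp
    ultimately show False
      using no_parabolic_hypersurface[OF assms hyp, of "- 1"] by simp
  }
  {
    assume "\<forall>p\<in>topspace (mtop S). mean_curvature S (plane_wave M \<H>) \<psi> d_v p \<ge> 0"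
      "bdd_below ((u_coord \<circ> \<psi>) ` topspace (mtop S))"
    then show False
      using no_parabolic_hypersurface[OF assms hyp, of 1] by (simp add: o_def)
  }
qed

end
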